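(* There exist $K^*$-algebras $A_1$, $A_2$ for which the projective locally convex topology $\pi$ on $A_1\otimes A_2$ is not an $LC^*$-topology.
   Context: "Algebra" means commutative associative algebra over $\mathbb{C}$ with unit. An involutive algebra is an algebra with a conjugate-linear map $x\mapsto x^*$ satisfying $(x^* )^*=x$, $(xy)^*=y^*x^*$. A $C^*$-seminorm is a seminorm $p$ with $p(xx^* )=p(x)^2$ for all $x$. An $LC^*$-topology is a topology on an involutive algebra defined by a family of $C^*$-seminorms. A $K^*$-algebra is an involutive algebra with a complete Hausdorff $LC^*$-topology. The algebraic tensor product $A_1\otimes A_2$ is an involutive algebra with $(x_1\otimes x_2)(y_1\otimes y_2)=x_1y_1\otimes x_2y_2$ and $(x_1\otimes x_2)^*=x_1^*\otimes x_2^*$. The projective topology $\pi$ is the strongest locally convex topology on $A_1\otimes A_2$ for which the canonical bilinear map $\otimes\colon A_1\times A_2\to A_1\otimes A_2$ is continuous. *)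

theory Defs
  imports
    "HOL-Algebra.Module"
    "HOL-Library.Poly_Mapping"
    "HOL-Analysis.T1_Spaces"
    "HOL-Analysis.Abstract_Limits"
begin

section \<open>Involutive algebras\<close>

definition complex_field :: "complex ring" where
  "complex_field =
     \<lparr>carrier = UNIV, monoid.mult = (*), one = 1, ring.zero = 0, add = (+)\<rparr>"

record 'a star_algebra = "(complex, 'a) module" +
  star :: "'a \<Rightarrow> 'a"

text \<open>
  The locale \<open>algebra\<close> of \<open>HOL-Algebra\<close> is already that of commutative associative
  unital algebras.
\<close>

locale involutive_algebra = Module.algebra complex_field A
  for A :: "('a, 'm) star_algebra_scheme" (structure) +
  assumes star_closed: "x \<in> carrier A \<Longrightarrow> star A x \<in> carrier A"
    and star_add: "\<lbrakk>x \<in> carrier A; y \<in> carrier A\<rbrakk> \<Longrightarrow> star A (x \<oplus> y) = star A x \<oplus> star A y"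
    and star_smult: "x \<in> carrier A \<Longrightarrow> star A (c \<odot> x) = cnj c \<odot> star A x"
    and star_star: "x \<in> carrier A \<Longrightarrow> star A (star A x) = x"
    and star_mult: "\<lbrakk>x \<in> carrier A; y \<in> carrier A\<rbrakk> \<Longrightarrow> star A (x \<otimes> y) = star A y \<otimes> star A x"


section \<open>Seminorms and the topologies they define\<close>

definition seminorm_on :: "(complex, 'a, 'm) module_scheme \<Rightarrow> ('a \<Rightarrow> real) \<Rightarrow> bool" where
  "seminorm_on V p \<longleftrightarrow>
     (\<forall>x\<in>carrier V. 0 \<le> p x) \<and>
     (\<forall>x\<in>carrier V. \<forall>y\<in>carrier V. p (x \<oplus>\<^bsub>V\<^esub> y) \<le> p x + p y) \<and>
     (\<forall>c. \<forall>x\<in>carrier V. p (c \<odot>\<^bsub>V\<^esub> x) = cmod c * p x)"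

definition cstar_seminorm_on :: "('a, 'm) star_algebra_scheme \<Rightarrow> ('a \<Rightarrow> real) \<Rightarrow> bool" where
  "cstar_seminorm_on A p \<longleftrightarrow>
     seminorm_on A p \<and> (\<forall>x\<in>carrier A. p (x \<otimes>\<^bsub>A\<^esub> star A x) = (p x)\<^sup>2)"

text \<open>
  The open balls of all \<open>p \<in> P\<close> form a subbase; the carrier is added so that the topology
  lives on the whole carrier also when \<open>P\<close> is empty.
\<close>

definition seminorm_topology ::
    "(complex, 'a, 'm) module_scheme \<Rightarrow> ('a \<Rightarrow> real) set \<Rightarrow> 'a topology" where
  "seminorm_topology V P = topology_generated_by
     (insert (carrier V)
       {{y \<in> carrier V. p (y \<ominus>\<^bsub>V\<^esub> x) < r} | p x r. p \<in> P \<and> x \<in> carrier V \<and> 0 < r})"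

definition locally_convex_topology ::
    "(complex, 'a, 'm) module_scheme \<Rightarrow> 'a topology \<Rightarrow> bool" where
  "locally_convex_topology V T \<longleftrightarrow>
     (\<exists>P. (\<forall>p\<in>P. seminorm_on V p) \<and> T = seminorm_topology V P)"

definition LCstar_topology :: "('a, 'm) star_algebra_scheme \<Rightarrow> 'a topology \<Rightarrow> bool" where
  "LCstar_topology A T \<longleftrightarrow>
     (\<exists>P. (\<forall>p\<in>P. cstar_seminorm_on A p) \<and> T = seminorm_topology A P)"


section \<open>\<open>K\<^sup>*\<close>-algebras\<close>

text \<open>
  Completeness refers to the uniformity of the additive group, whose entourages are given by
  the neighbourhoods of zero, and is expressed by filters.
\<close>

definition cauchy_filter_on ::
    "('a, 'm) ring_scheme \<Rightarrow> 'a topology \<Rightarrow> 'a filter \<Rightarrow> bool" where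
  "cauchy_filter_on G T F \<longleftrightarrow>
     eventually (\<lambda>x. x \<in> carrier G) F \<and>
     (\<forall>U. openin T U \<and> \<zero>\<^bsub>G\<^esub> \<in> U \<longrightarrow>
        (\<exists>S\<subseteq>carrier G. eventually (\<lambda>x. x \<in> S) F \<and> (\<forall>x\<in>S. \<forall>y\<in>S. x \<ominus>\<^bsub>G\<^esub> y \<in> U)))"

definition complete_topology :: "('a, 'm) ring_scheme \<Rightarrow> 'a topology \<Rightarrow> bool" where
  "complete_topology G T \<longleftrightarrow>
     (\<forall>F. F \<noteq> bot \<and> cauchy_filter_on G T F \<longrightarrow> (\<exists>l. limitin T (\<lambda>x. x) l F))"

definition Kstar_algebra :: "('a, 'm) star_algebra_scheme \<Rightarrow> 'a topology \<Rightarrow> bool" where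
  "Kstar_algebra A T \<longleftrightarrow>
     involutive_algebra A \<and> LCstar_topology A T \<and> Hausdorff_space T \<and> complete_topology A T"


section \<open>The algebraic tensor product\<close>

text \<open>
  The tensor product is the free complex vector space on \<open>carrier A \<times> carrier B\<close>, i.e. the
  finitely supported functions, modulo the subspace spanned by the bilinearity relations.
\<close>

definition free_scale :: "complex \<Rightarrow> ('i \<Rightarrow>\<^sub>0 complex) \<Rightarrow> ('i \<Rightarrow>\<^sub>0 complex)" where
  "free_scale c = Poly_Mapping.map ((*) c)"

definition free_space ::
    "('a, 'm) star_algebra_scheme \<Rightarrow> ('b, 'n) star_algebra_scheme \<Rightarrow> ('a \<times> 'b \<Rightarrow>\<^sub>0 complex) set" where
  "free_space A B = {f. Poly_Mapping.keys f \<subseteq> carrier A \<times> carrier B}"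

abbreviation free_gen :: "'a \<Rightarrow> 'b \<Rightarrow> ('a \<times> 'b \<Rightarrow>\<^sub>0 complex)" where
  "free_gen x y \<equiv> Poly_Mapping.single (x, y) 1"

definition bilinearity_relations ::
    "('a, 'm) star_algebra_scheme \<Rightarrow> ('b, 'n) star_algebra_scheme \<Rightarrow> ('a \<times> 'b \<Rightarrow>\<^sub>0 complex) set" where
  "bilinearity_relations A B =
     {free_gen (x \<oplus>\<^bsub>A\<^esub> x') y - free_gen x y - free_gen x' y | x x' y.
        x \<in> carrier A \<and> x' \<in> carrier A \<and> y \<in> carrier B} \<union>
     {free_gen x (y \<oplus>\<^bsub>B\<^esub> y') - free_gen x y - free_gen x y' | x y y'.
        x \<in> carrier A \<and> y \<in> carrier B \<and> y' \<in> carrier B} \<union>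
     {free_gen (c \<odot>\<^bsub>A\<^esub> x) y - free_scale c (free_gen x y) | c x y.
        x \<in> carrier A \<and> y \<in> carrier B} \<union>
     {free_gen x (c \<odot>\<^bsub>B\<^esub> y) - free_scale c (free_gen x y) | c x y.
        x \<in> carrier A \<and> y \<in> carrier B}"

definition tensor_rel ::
    "('a, 'm) star_algebra_scheme \<Rightarrow> ('b, 'n) star_algebra_scheme \<Rightarrow> ('a \<times> 'b \<Rightarrow>\<^sub>0 complex) rel" where
  "tensor_rel A B =
     {(f, g). f \<in> free_space A B \<and> g \<in> free_space A B \<and>
              f - g \<in> module.span free_scale (bilinearity_relations A B)}"

definition tensor_class ::
    "('a, 'm) star_algebra_scheme \<Rightarrow> ('b, 'n) star_algebra_scheme \<Rightarrow>
     ('a \<times> 'b \<Rightarrow>\<^sub>0 complex) \<Rightarrow> ('a \<times> 'b \<Rightarrow>\<^sub>0 complex) set" where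
  "tensor_class A B f = tensor_rel A B `` {f}"

text \<open>
  The (anti)linear extensions to the free space of the product and the involution on
  elementary tensors.
\<close>

definition free_mult ::
    "('a, 'm) star_algebra_scheme \<Rightarrow> ('b, 'n) star_algebra_scheme \<Rightarrow>
     ('a \<times> 'b \<Rightarrow>\<^sub>0 complex) \<Rightarrow> ('a \<times> 'b \<Rightarrow>\<^sub>0 complex) \<Rightarrow> ('a \<times> 'b \<Rightarrow>\<^sub>0 complex)" where
  "free_mult A B f g =
     (\<Sum>(x\<^sub>1, x\<^sub>2)\<in>Poly_Mapping.keys f. \<Sum>(y\<^sub>1, y\<^sub>2)\<in>Poly_Mapping.keys g.
        Poly_Mapping.single (x\<^sub>1 \<otimes>\<^bsub>A\<^esub> y\<^sub>1, x\<^sub>2 \<otimes>\<^bsub>B\<^esub> y\<^sub>2)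
          (Poly_Mapping.lookup f (x\<^sub>1, x\<^sub>2) * Poly_Mapping.lookup g (y\<^sub>1, y\<^sub>2)))"

definition free_star ::
    "('a, 'm) star_algebra_scheme \<Rightarrow> ('b, 'n) star_algebra_scheme \<Rightarrow>
     ('a \<times> 'b \<Rightarrow>\<^sub>0 complex) \<Rightarrow> ('a \<times> 'b \<Rightarrow>\<^sub>0 complex)" where
  "free_star A B f =
     (\<Sum>(x\<^sub>1, x\<^sub>2)\<in>Poly_Mapping.keys f.
        Poly_Mapping.single (star A x\<^sub>1, star B x\<^sub>2) (cnj (Poly_Mapping.lookup f (x\<^sub>1, x\<^sub>2))))"

text \<open>
  Operations on classes are unions over representatives; all the united classes coincide.
\<close>

definition tensor_algebra ::
    "('a, 'm) star_algebra_scheme \<Rightarrow> ('b, 'n) star_algebra_scheme \<Rightarrow>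
     ('a \<times> 'b \<Rightarrow>\<^sub>0 complex) set star_algebra" where
  "tensor_algebra A B =
     \<lparr>carrier = free_space A B // tensor_rel A B,
      monoid.mult = (\<lambda>X Y. \<Union>f\<in>X. \<Union>g\<in>Y. tensor_class A B (free_mult A B f g)),
      one = tensor_class A B (free_gen \<one>\<^bsub>A\<^esub> \<one>\<^bsub>B\<^esub>),
      ring.zero = tensor_class A B 0,
      add = (\<lambda>X Y. \<Union>f\<in>X. \<Union>g\<in>Y. tensor_class A B (f + g)),
      smult = (\<lambda>c X. \<Union>f\<in>X. tensor_class A B (free_scale c f)),
      star = (\<lambda>X. \<Union>f\<in>X. tensor_class A B (free_star A B f))\<rparr>"

definition tensor ::
    "('a, 'm) star_algebra_scheme \<Rightarrow> ('b, 'n) star_algebra_scheme \<Rightarrow>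
     'a \<Rightarrow> 'b \<Rightarrow> ('a \<times> 'b \<Rightarrow>\<^sub>0 complex) set" where
  "tensor A B x y = tensor_class A B (free_gen x y)"


section \<open>The projective topology\<close>

definition tensor_compatible_topology ::
    "('a, 'm) star_algebra_scheme \<Rightarrow> 'a topology \<Rightarrow> ('b, 'n) star_algebra_scheme \<Rightarrow> 'b topology \<Rightarrow>
     ('a \<times> 'b \<Rightarrow>\<^sub>0 complex) set topology \<Rightarrow> bool" where
  "tensor_compatible_topology A S B T W \<longleftrightarrow>
     locally_convex_topology (tensor_algebra A B) W \<and>
     continuous_map (prod_topology S T) W (\<lambda>(x, y). tensor A B x y)"

text \<open>Being the strongest such topology, it is unique.\<close>

definition is_projective_topology ::
    "('a, 'm) star_algebra_scheme \<Rightarrow> 'a topology \<Rightarrow> ('b, 'n) star_algebra_scheme \<Rightarrow> 'b topology \<Rightarrow>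
     ('a \<times> 'b \<Rightarrow>\<^sub>0 complex) set topology \<Rightarrow> bool" where
  "is_projective_topology A S B T \<pi> \<longleftrightarrow>
     tensor_compatible_topology A S B T \<pi> \<and>
     (\<forall>W. tensor_compatible_topology A S B T W \<longrightarrow> (\<forall>U. openin W U \<longrightarrow> openin \<pi> U))"

end

theory Submission
  imports Defs "HOL-Analysis.Elementary_Normed_Spaces" "HOL-Analysis.Convex"
begin

text \<open>
  Take for both algebras the bounded sequences with the supremum norm. Let
  \<open>z\<^sub>n = \<Sum>i<n. e\<^sub>i \<otimes> f\<^sub>i\<close>, where \<open>e\<^sub>i\<close> is the \<open>i\<close>-th unit sequence and \<open>f\<^sub>i\<close> the \<open>i\<close>-th row of
  the \<open>n \<times> n\<close> Fourier matrix. As its entries are unimodular, \<open>z\<^sub>n z\<^sub>n\<^sup>* = 1\<^sub>n \<otimes> 1\<close> is a projection, so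
  every \<open>C\<^sup>*\<close>-seminorm, continuous or not, is at most 1 at every \<open>z\<^sub>n\<close>. On the other hand, the
  orthogonality of the rows shows that the conjugate matrix divided by \<open>n * sqrt n\<close> is a bilinear
  form of norm at most 1. The supremum over \<open>n\<close> of the moduli of these forms is a continuous
  seminorm for the projective topology, and its value at \<open>z\<^sub>n\<close> is at least \<open>sqrt n\<close>.
\<close>

text \<open>If C*-seminorms defined the projective topology, some fixed
  \<open>\<epsilon> > 0\<close> would put \<open>(\<epsilon> / 2) z\<^sub>n\<close> for every
  \<open>n\<close> into the unit ball of a given projectively continuous seminorm, which would
  therefore be bounded along \<open>z\<^sub>n\<close>. The supremum over \<open>n\<close> is
  essential here: the form with index \<open>m\<close> alone has modulus at most
  \<open>sqrt m\<close> at every \<open>z\<^sub>n\<close>, so no single form detects the growth. The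
  obstacle is the quotient construction. The formula for \<open>z\<^sub>n z\<^sub>n\<^sup>*\<close>
  holds only modulo the bilinearity relations, so their span must be an ideal stable under the
  involution, and lower bounds come from bilinear forms because their linear extensions vanish on
  that span. The projective seminorms are never computed. The topology is built from all seminorms
  that make the tensor map continuous, and the argument rests on one explicit member of this
  family.\<close>

lemma complex_field_simps [simp]:
  "carrier complex_field = UNIV" "\<one>\<^bsub>complex_field\<^esub> = 1" "\<zero>\<^bsub>complex_field\<^esub> = 0"
  "x \<otimes>\<^bsub>complex_field\<^esub> y = x * y" "x \<oplus>\<^bsub>complex_field\<^esub> y = x + y"
  by (simp_all add: complex_field_def)

lemma cring_complex_field: "cring complex_field"
proof (intro cringI abelian_groupI comm_monoidI)
  show "\<exists>y\<in>carrier complex_field. y \<oplus>\<^bsub>complex_field\<^esub> x = \<zero>\<^bsub>complex_field\<^esub>" for x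
    by (auto intro!: exI [of _ "- x"])
qed (auto simp: algebra_simps)

section \<open>Seminorm topologies\<close>

context
  fixes V :: "(complex, 'a, 'm) module_scheme"
  assumes V: "Module.module complex_field V"
begin

interpretation Module.module complex_field V
  by (rule V)

lemma seminorm_zero: "seminorm_on V p \<Longrightarrow> p \<zero>\<^bsub>V\<^esub> = 0"
  using smult_l_null [of "\<zero>\<^bsub>V\<^esub>"] M.zero_closed
  by (metis complex_field_simps(3) mult_zero_left norm_zero seminorm_on_def)

lemma seminorm_minus_triangle:
  assumes "seminorm_on V p" "x \<in> carrier V" "y \<in> carrier V" "z \<in> carrier V"
  shows "p (x \<ominus>\<^bsub>V\<^esub> z) \<le> p (x \<ominus>\<^bsub>V\<^esub> y) + p (y \<ominus>\<^bsub>V\<^esub> z)"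
proof -
  have "x \<ominus>\<^bsub>V\<^esub> z = (x \<ominus>\<^bsub>V\<^esub> y) \<oplus>\<^bsub>V\<^esub> (y \<ominus>\<^bsub>V\<^esub> z)"
    using assms(2-4) by (simp add: M.minus_eq M.a_ac M.r_neg1 M.r_neg2)
  then show ?thesis
    using assms unfolding seminorm_on_def by simp
qed

lemma topspace_seminorm_topology [simp]: "topspace (seminorm_topology V P) = carrier V"
  by (auto simp: seminorm_topology_def)

lemma openin_seminorm_ball:
  assumes "p \<in> P" "x \<in> carrier V" "0 < r"
  shows "openin (seminorm_topology V P) {y \<in> carrier V. p (y \<ominus>\<^bsub>V\<^esub> x) < r}"
  unfolding seminorm_topology_def using assms by (intro topology_generated_by_Basis) blast

text \<open>Induction on the generation of \<open>U\<close> from the subbase. One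
  \<open>\<epsilon>\<close> bounds all \<open>p \<in> P\<close> simultaneously, so for infinite
  \<open>P\<close> the set described need not be a neighbourhood of \<open>x\<close>. This form
  still suffices: all C*-seminorms share the bound 1 on the critical elements, and in the
  completeness proof \<open>P\<close> is a singleton.\<close>

lemma seminorm_ball_subset_open:
  assumes P: "\<And>p. p \<in> P \<Longrightarrow> seminorm_on V p"
    and "openin (seminorm_topology V P) U" "x \<in> U"
  shows "\<exists>\<epsilon>>0. \<forall>y\<in>carrier V. (\<forall>p\<in>P. p (y \<ominus>\<^bsub>V\<^esub> x) < \<epsilon>) \<longrightarrow> y \<in> U"
proof -
  have x: "x \<in> carrier V"
    using assms(2,3) openin_subset by fastforce
  have "generate_topology_on (insert (carrier V)
      {{y \<in> carrier V. p (y \<ominus>\<^bsub>V\<^esub> x) < r} | p x r. p \<in> P \<and> x \<in> carrier V \<and> 0 < r}) U"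
    using assms(2) by (simp add: seminorm_topology_def openin_topology_generated_by)
  then show ?thesis
    using \<open>x \<in> U\<close>
  proof induction
    case (Int U1 U2)
    obtain e1 where e1: "e1 > 0" "\<forall>y\<in>carrier V. (\<forall>p\<in>P. p (y \<ominus>\<^bsub>V\<^esub> x) < e1) \<longrightarrow> y \<in> U1"
      using Int.IH(1) Int.prems by blast
    obtain e2 where e2: "e2 > 0" "\<forall>y\<in>carrier V. (\<forall>p\<in>P. p (y \<ominus>\<^bsub>V\<^esub> x) < e2) \<longrightarrow> y \<in> U2"
      using Int.IH(2) Int.prems by blast
    show ?case
      using e1 e2 by (intro exI [of _ "min e1 e2"]) simp
  next
    case (UN K)
    then obtain W where "W \<in> K" "x \<in> W"
      by blast
    then obtain e where "e > 0" "\<forall>y\<in>carrier V. (\<forall>p\<in>P. p (y \<ominus>\<^bsub>V\<^esub> x) < e) \<longrightarrow> y \<in> W"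
      using UN.IH by blast
    then show ?case
      using \<open>W \<in> K\<close> by (intro exI [of _ e]) blast
  next
    case (Basis U)
    then consider "U = carrier V" | p a r where "p \<in> P" "a \<in> carrier V" "0 < r"
        "U = {y \<in> carrier V. p (y \<ominus>\<^bsub>V\<^esub> a) < r}"
      by blast
    then show ?case
    proof cases
      case 1
      then show ?thesis
        by (intro exI [of _ 1]) auto
    next
      case 2
      define \<delta> where "\<delta> = r - p (x \<ominus>\<^bsub>V\<^esub> a)"
      have "\<delta> > 0"
        using Basis(2) 2(4) by (simp add: \<delta>_def)
      have "y \<in> U" if y: "y \<in> carrier V" "\<forall>p\<in>P. p (y \<ominus>\<^bsub>V\<^esub> x) < \<delta>" for y
      proof -
        have "p (y \<ominus>\<^bsub>V\<^esub> x) < \<delta>"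
          using y(2) 2(1) by blast
        then show ?thesis
          using seminorm_minus_triangle [OF P [OF 2(1)] y(1) x 2(2)] y(1) 2(4)
          by (simp add: \<delta>_def)
      qed
      then show ?thesis
        using \<open>\<delta> > 0\<close> by (intro exI [of _ \<delta>] conjI ballI impI)
    qed
  qed simp
qed

end

section \<open>The algebra of bounded sequences\<close>

definition bounded_sequences :: "(nat \<Rightarrow> complex) star_algebra" where
  "bounded_sequences =
     \<lparr>carrier = {x. bounded (range x)}, monoid.mult = (\<lambda>x y n. x n * y n), one = (\<lambda>n. 1),
      ring.zero = (\<lambda>n. 0), add = (\<lambda>x y n. x n + y n), smult = (\<lambda>c x n. c * x n),
      star = (\<lambda>x n. cnj (x n))\<rparr>"

definition sup_norm :: "(nat \<Rightarrow> complex) \<Rightarrow> real" where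
  "sup_norm x = (SUP n. cmod (x n))"

lemma bounded_sequences_simps [simp]:
  "x \<in> carrier bounded_sequences \<longleftrightarrow> bounded (range x)"
  "\<one>\<^bsub>bounded_sequences\<^esub> = (\<lambda>n. 1)" "\<zero>\<^bsub>bounded_sequences\<^esub> = (\<lambda>n. 0)"
  "x \<otimes>\<^bsub>bounded_sequences\<^esub> y = (\<lambda>n. x n * y n)"
  "x \<oplus>\<^bsub>bounded_sequences\<^esub> y = (\<lambda>n. x n + y n)"
  "c \<odot>\<^bsub>bounded_sequences\<^esub> x = (\<lambda>n. c * x n)"
  "star bounded_sequences x = (\<lambda>n. cnj (x n))"
  by (simp_all add: bounded_sequences_def)

lemma bounded_rangeI: "(\<And>n. cmod (x n) \<le> B) \<Longrightarrow> bounded (range x)"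
  by (auto simp: bounded_iff)

lemma cmod_le_sup_norm: "bounded (range x) \<Longrightarrow> cmod (x n) \<le> sup_norm x"
  unfolding sup_norm_def
  by (rule cSUP_upper) (auto simp: bounded_iff bdd_above_def)

lemma sup_norm_le: "(\<And>n. cmod (x n) \<le> B) \<Longrightarrow> sup_norm x \<le> B"
  unfolding sup_norm_def by (rule cSUP_least) auto

lemma sup_norm_nonneg: "bounded (range x) \<Longrightarrow> 0 \<le> sup_norm x"
  using cmod_le_sup_norm [of x 0] norm_ge_zero order_trans by blast

lemma bounded_mult_range:
  fixes x y :: "nat \<Rightarrow> complex"
  assumes "bounded (range x)" "bounded (range y)"
  shows "bounded (range (\<lambda>n. x n * y n))"
  by (rule bounded_rangeI [where B = "sup_norm x * sup_norm y"])
    (auto simp: norm_mult intro!: mult_mono cmod_le_sup_norm sup_norm_nonneg assms)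

lemma bounded_cmult_range:
  fixes x :: "nat \<Rightarrow> complex"
  shows "bounded (range x) \<Longrightarrow> bounded (range (\<lambda>n. c * x n))"
  by (rule bounded_mult_range) auto

lemma bounded_add_range:
  fixes x y :: "nat \<Rightarrow> complex"
  assumes "bounded (range x)" "bounded (range y)"
  shows "bounded (range (\<lambda>n. x n + y n))"
  by (rule bounded_rangeI [where B = "sup_norm x + sup_norm y"])
    (intro norm_triangle_mono cmod_le_sup_norm assms)

lemma bounded_cnj_range: "bounded (range x) \<Longrightarrow> bounded (range (\<lambda>n. cnj (x n)))"
  by (auto simp: bounded_iff)

lemma cring_bounded_sequences: "cring bounded_sequences"
proof (intro cringI abelian_groupI comm_monoidI)
  fix x assume "x \<in> carrier bounded_sequences"
  then show "\<exists>y\<in>carrier bounded_sequences.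
      y \<oplus>\<^bsub>bounded_sequences\<^esub> x = \<zero>\<^bsub>bounded_sequences\<^esub>"
    using bounded_cmult_range [of x "-1"] by (intro bexI [of _ "\<lambda>n. - x n"]) auto
qed (auto simp: algebra_simps intro: bounded_mult_range bounded_add_range)

lemma involutive_algebra_bounded_sequences: "involutive_algebra bounded_sequences"
proof (intro involutive_algebra.intro involutive_algebra_axioms.intro algebraI)
qed (auto simp: algebra_simps cring_complex_field cring_bounded_sequences
    intro: bounded_cmult_range bounded_cnj_range)

interpretation bs: involutive_algebra bounded_sequences
  by (rule involutive_algebra_bounded_sequences)

lemma module_bounded_sequences: "Module.module complex_field bounded_sequences"
  by (rule bs.module_axioms)

lemma minus_bounded_sequences:
  assumes "bounded (range x)" "bounded (range y)"
  shows "x \<ominus>\<^bsub>bounded_sequences\<^esub> y = (\<lambda>n. x n - y n)"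
proof -
  have "\<ominus>\<^bsub>bounded_sequences\<^esub> y = (\<lambda>n. - y n)"
    using assms bounded_cmult_range [of y "-1"] by (intro bs.M.minus_equality) auto
  then show ?thesis
    by (simp add: bs.M.minus_eq)
qed

lemma cstar_seminorm_sup_norm: "cstar_seminorm_on bounded_sequences sup_norm"
proof -
  have add: "sup_norm (\<lambda>n. x n + y n) \<le> sup_norm x + sup_norm y"
    if "bounded (range x)" "bounded (range y)" for x y
    by (rule sup_norm_le) (intro norm_triangle_mono cmod_le_sup_norm that)
  have scale: "sup_norm (\<lambda>n. c * x n) \<le> cmod c * sup_norm x" if "bounded (range x)" for c x
    by (rule sup_norm_le) (simp add: norm_mult mult_left_mono cmod_le_sup_norm that)
  have "sup_norm (\<lambda>n. c * x n) = cmod c * sup_norm x" if x: "bounded (range x)" for c x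
  proof (cases "c = 0")
    case True
    then show ?thesis
      by (simp add: sup_norm_def)
  next
    case False
    \<comment> \<open>The reverse inequality is \<open>scale\<close> itself, applied to the scalar
      \<open>inverse c\<close> and the sequence \<open>c x\<close>.\<close>
    then have "cmod c * sup_norm x = cmod c * sup_norm (\<lambda>n. inverse c * (c * x n))"
      by (simp add: field_simps)
    also have "\<dots> \<le> cmod c * (cmod (inverse c) * sup_norm (\<lambda>n. c * x n))"
      by (intro mult_left_mono scale bounded_cmult_range x) auto
    also have "\<dots> = sup_norm (\<lambda>n. c * x n)"
      using False by (simp add: norm_inverse)
    finally show ?thesis
      using scale [OF x, of c] by simp
  qed
  moreover have "sup_norm (\<lambda>n. x n * cnj (x n)) = (sup_norm x)\<^sup>2" if x: "bounded (range x)" for x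
  proof (rule antisym)
    show "sup_norm (\<lambda>n. x n * cnj (x n)) \<le> (sup_norm x)\<^sup>2"
      by (rule sup_norm_le)
        (auto simp: norm_mult power2_eq_square intro!: mult_mono cmod_le_sup_norm sup_norm_nonneg x)
    \<comment> \<open>The square root is taken in each coordinate before passing to the supremum, so
      that squaring need not be exchanged with \<open>SUP\<close>.\<close>
    have "sup_norm x \<le> sqrt (sup_norm (\<lambda>n. x n * cnj (x n)))"
    proof (rule sup_norm_le)
      fix n
      have "(cmod (x n))\<^sup>2 = cmod (x n * cnj (x n))"
        by (simp add: norm_mult power2_eq_square)
      also have "\<dots> \<le> sup_norm (\<lambda>n. x n * cnj (x n))"
        by (rule cmod_le_sup_norm [of "\<lambda>n. x n * cnj (x n)"])
          (intro bounded_mult_range bounded_cnj_range x)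
      finally show "cmod (x n) \<le> sqrt (sup_norm (\<lambda>n. x n * cnj (x n)))"
        by (rule real_le_rsqrt)
    qed
    then show "(sup_norm x)\<^sup>2 \<le> sup_norm (\<lambda>n. x n * cnj (x n))"
      using power_mono [OF _ sup_norm_nonneg [OF x], of _ 2]
        sup_norm_nonneg [OF bounded_mult_range [OF x bounded_cnj_range [OF x]]]
      by (metis real_sqrt_pow2)
  qed
  ultimately show ?thesis
    using add by (auto simp: cstar_seminorm_on_def seminorm_on_def sup_norm_nonneg)
qed

lemma seminorm_sup_norm: "seminorm_on bounded_sequences sup_norm"
  using cstar_seminorm_sup_norm by (simp add: cstar_seminorm_on_def)

section \<open>The supremum-norm topology: separation and completeness\<close>

abbreviation sup_topology :: "(nat \<Rightarrow> complex) topology" where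
  "sup_topology \<equiv> seminorm_topology bounded_sequences {sup_norm}"

lemma Hausdorff_sup_topology: "Hausdorff_space sup_topology"
  unfolding Hausdorff_space_def
proof (intro allI impI, elim conjE)
  fix x y assume "x \<in> topspace sup_topology" "y \<in> topspace sup_topology" "x \<noteq> y"
  then have xy: "bounded (range x)" "bounded (range y)"
    by (simp_all add: topspace_seminorm_topology [OF module_bounded_sequences])
  obtain n where n: "x n \<noteq> y n"
    using \<open>x \<noteq> y\<close> by blast
  \<comment> \<open>Evaluation at \<open>n\<close> does not increase distances, so balls whose
    radius is half the gap in this one coordinate cannot meet.\<close>
  define r where "r = cmod (x n - y n) / 2"
  define ball where "ball a = {u \<in> carrier bounded_sequences.
    sup_norm (u \<ominus>\<^bsub>bounded_sequences\<^esub> a) < r}" for a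
  have "r > 0"
    using n by (simp add: r_def)
  have cmod_ball: "cmod (u n - a n) < r" if "u \<in> ball a" "bounded (range a)" for u a
    using that cmod_le_sup_norm [of "\<lambda>n. u n - a n" n] bs.M.minus_closed [of u a]
    by (auto simp: ball_def minus_bounded_sequences)
  have center: "a \<in> ball a" if "bounded (range a)" for a
    using that \<open>r > 0\<close> by (simp add: ball_def minus_bounded_sequences sup_norm_def)
  have "u \<notin> ball y" if "u \<in> ball x" for u
  proof
    assume "u \<in> ball y"
    have "cmod (x n - y n) \<le> cmod (u n - x n) + cmod (u n - y n)"
      using norm_triangle_ineq [of "x n - u n" "u n - y n"] by (simp add: norm_minus_commute)
    then show False
      using cmod_ball [OF that xy(1)] cmod_ball [OF \<open>u \<in> ball y\<close> xy(2)] by (simp add: r_def)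
  qed
  moreover have "openin sup_topology (ball a)" if "bounded (range a)" for a
    unfolding ball_def
    by (rule openin_seminorm_ball [OF module_bounded_sequences]) (use that \<open>r > 0\<close> in auto)
  ultimately show "\<exists>U W. openin sup_topology U \<and> openin sup_topology W \<and> x \<in> U \<and> y \<in> W \<and> disjnt U W"
    using xy center by (intro exI [of _ "ball x"] exI [of _ "ball y"]) (auto simp: disjnt_iff)
qed

text \<open>The Cauchy filter is reduced to a sequence: members \<open>S k\<close> of small diameter
  are chosen, and one point is taken from each finite intersection. The coordinatewise limit of
  these points is approached uniformly, because the bound on \<open>S i\<close> is the same in all
  coordinates.\<close>

lemma complete_sup_topology: "complete_topology bounded_sequences sup_topology"
  unfolding complete_topology_def
proof (intro allI impI, elim conjE)
  fix F assume F: "F \<noteq> bot" and cauchy: "cauchy_filter_on bounded_sequences sup_topology F"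
  have "\<exists>S\<subseteq>carrier bounded_sequences. eventually (\<lambda>x. x \<in> S) F \<and>
      (\<forall>x\<in>S. \<forall>y\<in>S. sup_norm (\<lambda>n. x n - y n) < 1 / Suc k)" for k :: nat
  proof -
    let ?U = "{u \<in> carrier bounded_sequences.
      sup_norm (u \<ominus>\<^bsub>bounded_sequences\<^esub> \<zero>\<^bsub>bounded_sequences\<^esub>) < 1 / Suc k}"
    have "openin sup_topology ?U"
      by (rule openin_seminorm_ball [OF module_bounded_sequences]) auto
    moreover have "\<zero>\<^bsub>bounded_sequences\<^esub> \<in> ?U"
      by (simp add: minus_bounded_sequences sup_norm_def)
    ultimately obtain S where S: "S \<subseteq> carrier bounded_sequences" "eventually (\<lambda>x. x \<in> S) F"
      "\<forall>x\<in>S. \<forall>y\<in>S. x \<ominus>\<^bsub>bounded_sequences\<^esub> y \<in> ?U"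
      using cauchy unfolding cauchy_filter_on_def by blast
    have "sup_norm (\<lambda>n. x n - y n) < 1 / Suc k" if "x \<in> S" "y \<in> S" for x y
    proof -
      have xy: "bounded (range x)" "bounded (range y)"
        using that S(1) by auto
      have "x \<ominus>\<^bsub>bounded_sequences\<^esub> y \<in> ?U"
        using S(3) that by blast
      moreover have "bounded (range (\<lambda>n. x n - y n))"
        using xy bs.M.minus_closed [of x y] by (simp add: minus_bounded_sequences)
      ultimately show ?thesis
        using xy by (simp add: minus_bounded_sequences)
    qed
    then show ?thesis
      using S by blast
  qed
  then obtain S where S: "\<And>k. S k \<subseteq> carrier bounded_sequences" "\<And>k. eventually (\<lambda>x. x \<in> S k) F"
    "\<And>k x y. x \<in> S k \<Longrightarrow> y \<in> S k \<Longrightarrow> sup_norm (\<lambda>n. x n - y n) < 1 / Suc k"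
    by metis
  have S_bounded: "bounded (range x)" if "x \<in> S k" for x k
    using that S(1) [of k] by auto
  have close: "cmod (x n - y n) < 1 / Suc k" if "x \<in> S k" "y \<in> S k" for x y k n
  proof -
    have "bounded (range (\<lambda>n. x n - y n))"
      using bs.M.minus_closed [of x y] that by (simp add: minus_bounded_sequences S_bounded)
    then show ?thesis
      using cmod_le_sup_norm [of "\<lambda>n. x n - y n" n] S(3) [OF that] by simp
  qed
  \<comment> \<open>Finite intersections of members of a proper filter are inhabited. The sets
    \<open>S i\<close> need not decrease, so \<open>y k\<close> is taken from all of
    \<open>S 0\<close> to \<open>S k\<close>; then a tail of \<open>y\<close> lies in each
    \<open>S i\<close>.\<close>
  have "\<exists>x. \<forall>i\<le>k. x \<in> S i" for k
    using eventually_happens' [OF F, of "\<lambda>x. \<forall>i\<in>{..k}. x \<in> S i"] S(2)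
    by (auto simp: eventually_ball_finite_distrib)
  then obtain y where y: "\<And>k i. i \<le> k \<Longrightarrow> y k \<in> S i"
    by metis
  have "Cauchy (\<lambda>k. y k n)" for n
  proof (rule metric_CauchyI)
    fix e :: real assume "e > 0"
    then obtain i where "1 / Suc i < e"
      using nat_approx_posE by blast
    then have "dist (y j n) (y k n) < e" if "j \<ge> i" "k \<ge> i" for j k
      using close [OF y [OF that(1)] y [OF that(2)], of n] by (simp add: dist_norm)
    then show "\<exists>M. \<forall>m\<ge>M. \<forall>k\<ge>M. dist (y m n) (y k n) < e"
      by blast
  qed
  then have "\<exists>l. (\<lambda>k. y k n) \<longlonglongrightarrow> l" for n
    by (simp add: Cauchy_convergent convergent_def [symmetric])
  then obtain l where l: "\<And>n. (\<lambda>k. y k n) \<longlonglongrightarrow> l n"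
    by metis
  \<comment> \<open>The estimate \<open>close\<close> between \<open>x\<close> and
    \<open>y k\<close> holds once \<open>k \<ge> i\<close>; as \<open>k\<close> grows it passes to
    the limit and loses its strictness.\<close>
  have lim: "cmod (x n - l n) \<le> 1 / Suc i" if "x \<in> S i" for x n i
  proof (rule tendsto_upperbound)
    show "(\<lambda>k. cmod (x n - y k n)) \<longlonglongrightarrow> cmod (x n - l n)"
      by (intro tendsto_intros l)
    show "\<forall>\<^sub>F k in sequentially. cmod (x n - y k n) \<le> 1 / Suc i"
      using eventually_ge_at_top [of i]
      by eventually_elim (use close [OF that y] in \<open>auto intro: less_imp_le\<close>)
  qed simp
  have bl: "bounded (range l)"
  proof (rule bounded_rangeI)
    fix n
    have "bounded (range (y 0))"
      using S_bounded [OF y [of 0 0]] by simp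
    moreover have "cmod (l n) \<le> cmod (y 0 n) + cmod (y 0 n - l n)"
      by (metis norm_minus_commute norm_triangle_sub)
    ultimately show "cmod (l n) \<le> sup_norm (y 0) + 1"
      using cmod_le_sup_norm [of "y 0" n] lim [OF y [of 0 0], of n] by simp
  qed
  have "limitin sup_topology (\<lambda>x. x) l F"
    unfolding limitin_def
  proof (intro conjI allI impI)
    show "l \<in> topspace sup_topology"
      using bl by (simp add: topspace_seminorm_topology [OF module_bounded_sequences])
    fix U assume "openin sup_topology U \<and> l \<in> U"
    then have U: "openin sup_topology U" "l \<in> U"
      by auto
    then obtain e where e: "e > 0" "\<forall>x\<in>carrier bounded_sequences.
        sup_norm (x \<ominus>\<^bsub>bounded_sequences\<^esub> l) < e \<longrightarrow> x \<in> U"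
      using seminorm_ball_subset_open [OF module_bounded_sequences _ U] seminorm_sup_norm by auto
    obtain i where i: "1 / Suc i < e"
      using nat_approx_posE [OF \<open>e > 0\<close>] by blast
    have "x \<in> U" if "x \<in> S i" for x
    proof -
      have x: "bounded (range x)"
        using that by (rule S_bounded)
      have "sup_norm (\<lambda>n. x n - l n) \<le> 1 / Suc i"
        by (rule sup_norm_le) (rule lim [OF that])
      then show ?thesis
        using e(2) x bl i by (auto simp: minus_bounded_sequences)
    qed
    then show "\<forall>\<^sub>F x in F. x \<in> U"
      using S(2) [of i] by (rule eventually_mono [rotated])
  qed
  then show "\<exists>l. limitin sup_topology (\<lambda>x. x) l F"
    by (intro exI [where P = "\<lambda>l. limitin sup_topology (\<lambda>x. x) l F" and x = l])
qed

lemma Kstar_algebra_bounded_sequences: "Kstar_algebra bounded_sequences sup_topology"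
proof -
  have "LCstar_topology bounded_sequences sup_topology"
    unfolding LCstar_topology_def using cstar_seminorm_sup_norm by (intro exI [of _ "{sup_norm}"]) simp
  then show ?thesis
    by (simp add: Kstar_algebra_def involutive_algebra_bounded_sequences Hausdorff_sup_topology
        complete_sup_topology)
qed

section \<open>The tensor product as a module\<close>

lemma lookup_free_scale [simp]:
  "Poly_Mapping.lookup (free_scale c f) k = c * Poly_Mapping.lookup f k"
  by (simp add: free_scale_def Poly_Mapping.map.rep_eq when_def)

lemma free_scale_single [simp]:
  "free_scale c (Poly_Mapping.single k d) = Poly_Mapping.single k (c * d)"
  by (rule poly_mapping_eqI) (simp add: lookup_single when_def)

interpretation free: Modules.module free_scale
  by standard (auto intro!: poly_mapping_eqI simp: lookup_add algebra_simps)

section \<open>Linear functionals on the free space\<close>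

definition linear_extension :: "('i \<Rightarrow> complex) \<Rightarrow> ('i \<Rightarrow>\<^sub>0 complex) \<Rightarrow> complex" where
  "linear_extension b f = (\<Sum>k\<in>Poly_Mapping.keys f. Poly_Mapping.lookup f k * b k)"

text \<open>The supports of \<open>f\<close>, \<open>g\<close> and \<open>f + g\<close> differ.
  Summing over a common finite superset makes linearity a termwise matter;
  \<open>free_mult_superset\<close> and \<open>free_star_superset\<close> serve the same
  purpose.\<close>

lemma linear_extension_superset:
  assumes "finite K" "Poly_Mapping.keys f \<subseteq> K"
  shows "linear_extension b f = (\<Sum>k\<in>K. Poly_Mapping.lookup f k * b k)"
  unfolding linear_extension_def using assms
  by (intro sum.mono_neutral_left) (auto simp: in_keys_iff)

lemma linear_extension_add: "linear_extension b (f + g) = linear_extension b f + linear_extension b g"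
proof -
  let ?K = "Poly_Mapping.keys f \<union> Poly_Mapping.keys g"
  have "Poly_Mapping.keys (f + g) \<subseteq> ?K"
    by (rule Poly_Mapping.keys_add)
  then show ?thesis
    by (simp add: linear_extension_superset [of ?K] lookup_add sum.distrib algebra_simps)
qed

lemma linear_extension_scale: "linear_extension b (free_scale c f) = c * linear_extension b f"
proof -
  have "Poly_Mapping.keys (free_scale c f) \<subseteq> Poly_Mapping.keys f"
    by (auto simp: in_keys_iff)
  then show ?thesis
    by (simp add: linear_extension_superset [of "Poly_Mapping.keys f"] sum_distrib_left mult.assoc)
qed

lemma linear_extension_diff: "linear_extension b (f - g) = linear_extension b f - linear_extension b g"
  using linear_extension_add [of b "f - g" g] by simp

lemma linear_extension_single [simp]: "linear_extension b (Poly_Mapping.single k c) = c * b k"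
  by (simp add: linear_extension_def)

lemma linear_extension_zero [simp]: "linear_extension b 0 = 0"
  by (simp add: linear_extension_def)

lemma linear_extension_sum: "linear_extension b (\<Sum>i\<in>I. f i) = (\<Sum>i\<in>I. linear_extension b (f i))"
  by (induction I rule: infinite_finite_induct) (simp_all add: linear_extension_add)

lemma poly_mapping_eq_sum_single:
  "f = (\<Sum>k\<in>Poly_Mapping.keys f. Poly_Mapping.single k (Poly_Mapping.lookup f k))"
  by (rule poly_mapping_eqI) (simp add: lookup_sum lookup_single when_def in_keys_iff)

text \<open>The four clauses mirror the four families in \<open>bilinearity_relations\<close>, so
  that the linear extension kills each generator of the null span. Nothing is asked outside the
  carriers.\<close>

definition bilinear_form ::
    "('a, 'm) star_algebra_scheme \<Rightarrow> ('b, 'n) star_algebra_scheme \<Rightarrow> ('a \<times> 'b \<Rightarrow> complex) \<Rightarrow> bool" where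
  "bilinear_form A B b \<longleftrightarrow>
     (\<forall>x\<in>carrier A. \<forall>x'\<in>carrier A. \<forall>y\<in>carrier B. b (x \<oplus>\<^bsub>A\<^esub> x', y) = b (x, y) + b (x', y)) \<and>
     (\<forall>x\<in>carrier A. \<forall>y\<in>carrier B. \<forall>y'\<in>carrier B. b (x, y \<oplus>\<^bsub>B\<^esub> y') = b (x, y) + b (x, y')) \<and>
     (\<forall>c. \<forall>x\<in>carrier A. \<forall>y\<in>carrier B. b (c \<odot>\<^bsub>A\<^esub> x, y) = c * b (x, y)) \<and>
     (\<forall>c. \<forall>x\<in>carrier A. \<forall>y\<in>carrier B. b (x, c \<odot>\<^bsub>B\<^esub> y) = c * b (x, y))"

locale involutive_algebra_pair = A: involutive_algebra A + B: involutive_algebra B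
  for A :: "('a, 'm) star_algebra_scheme" and B :: "('b, 'n) star_algebra_scheme"
begin

abbreviation F where "F \<equiv> free_space A B"
abbreviation null_span where "null_span \<equiv> free.span (bilinearity_relations A B)"
abbreviation cls where "cls \<equiv> tensor_class A B"
abbreviation AB where "AB \<equiv> tensor_algebra A B"

lemma free_space_zero [simp]: "0 \<in> F"
  by (simp add: free_space_def)

lemma free_space_add [simp]: "f \<in> F \<Longrightarrow> g \<in> F \<Longrightarrow> f + g \<in> F"
  using Poly_Mapping.keys_add [of f g] by (auto simp: free_space_def)

lemma free_space_scale [simp]: "f \<in> F \<Longrightarrow> free_scale c f \<in> F"
  by (auto simp: free_space_def in_keys_iff)

lemma free_space_diff [simp]: "f \<in> F \<Longrightarrow> g \<in> F \<Longrightarrow> f - g \<in> F"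
  using free_space_add [OF _ free_space_scale, of f g "-1"] by simp

lemma free_space_single [simp]:
  "x \<in> carrier A \<Longrightarrow> y \<in> carrier B \<Longrightarrow> Poly_Mapping.single (x, y) c \<in> F"
  by (simp add: free_space_def)

lemma free_space_sum: "(\<And>i. i \<in> I \<Longrightarrow> f i \<in> F) \<Longrightarrow> (\<Sum>i\<in>I. f i) \<in> F"
  by (induction I rule: infinite_finite_induct) simp_all

text \<open>The arguments that a map respects the quotient check the generators of the null span one
  family at a time, through this rule.\<close>

lemma relation_cases [consumes 1, case_names add_left add_right scale_left scale_right]:
  assumes "r \<in> bilinearity_relations A B"
  obtains x x' y where "x \<in> carrier A" "x' \<in> carrier A" "y \<in> carrier B"
      "r = free_gen (x \<oplus>\<^bsub>A\<^esub> x') y - free_gen x y - free_gen x' y"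
    | x y y' where "x \<in> carrier A" "y \<in> carrier B" "y' \<in> carrier B"
      "r = free_gen x (y \<oplus>\<^bsub>B\<^esub> y') - free_gen x y - free_gen x y'"
    | c x y where "x \<in> carrier A" "y \<in> carrier B"
      "r = free_gen (c \<odot>\<^bsub>A\<^esub> x) y - free_scale c (free_gen x y)"
    | c x y where "x \<in> carrier A" "y \<in> carrier B"
      "r = free_gen x (c \<odot>\<^bsub>B\<^esub> y) - free_scale c (free_gen x y)"
  using assms unfolding bilinearity_relations_def by (elim UnE CollectE exE conjE) metis+

lemma null_add_left:
  "x \<in> carrier A \<Longrightarrow> x' \<in> carrier A \<Longrightarrow> y \<in> carrier B \<Longrightarrow>
    free_gen (x \<oplus>\<^bsub>A\<^esub> x') y - free_gen x y - free_gen x' y \<in> null_span"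
  unfolding bilinearity_relations_def by (intro free.span_base) blast

lemma null_add_right:
  "x \<in> carrier A \<Longrightarrow> y \<in> carrier B \<Longrightarrow> y' \<in> carrier B \<Longrightarrow>
    free_gen x (y \<oplus>\<^bsub>B\<^esub> y') - free_gen x y - free_gen x y' \<in> null_span"
  unfolding bilinearity_relations_def by (intro free.span_base) blast

lemma null_scale_left:
  "x \<in> carrier A \<Longrightarrow> y \<in> carrier B \<Longrightarrow>
    free_gen (c \<odot>\<^bsub>A\<^esub> x) y - free_scale c (free_gen x y) \<in> null_span"
  unfolding bilinearity_relations_def by (intro free.span_base) blast

lemma null_scale_right:
  "x \<in> carrier A \<Longrightarrow> y \<in> carrier B \<Longrightarrow>
    free_gen x (c \<odot>\<^bsub>B\<^esub> y) - free_scale c (free_gen x y) \<in> null_span"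
  unfolding bilinearity_relations_def by (intro free.span_base) blast

text \<open>The scaling relation with scalar 0: its second term vanishes in the free space, whereas
  the generator at \<open>(0, y)\<close> does not and is only null.\<close>

lemma null_zero_left: "y \<in> carrier B \<Longrightarrow> free_gen \<zero>\<^bsub>A\<^esub> y \<in> null_span"
  using null_scale_left [of "\<zero>\<^bsub>A\<^esub>" y 0] A.smult_l_null [of "\<zero>\<^bsub>A\<^esub>"] by simp

lemma null_span_subset_free_space: "r \<in> null_span \<Longrightarrow> r \<in> F"
proof (induction rule: free.span_induct_alt)
  case (step c r s)
  from step(1) have "r \<in> F"
    by (cases rule: relation_cases) (simp_all del: free_scale_single)
  then show ?case
    using step by simp
qed simp

lemma equiv_tensor_rel: "equiv F (tensor_rel A B)"
proof (intro equivI)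
  show "tensor_rel A B \<subseteq> F \<times> F"
    by (auto simp: tensor_rel_def)
  show "refl_on F (tensor_rel A B)"
    by (auto simp: tensor_rel_def refl_on_def free.span_zero)
  show "sym (tensor_rel A B)"
    unfolding tensor_rel_def sym_def using free.span_neg by fastforce
  show "trans (tensor_rel A B)"
    unfolding tensor_rel_def trans_def using free.span_add by fastforce
qed

lemma cls_eq_iff: "f \<in> F \<Longrightarrow> g \<in> F \<Longrightarrow> cls f = cls g \<longleftrightarrow> f - g \<in> null_span"
  unfolding tensor_class_def
  using eq_equiv_class_iff [OF equiv_tensor_rel] by (auto simp: tensor_rel_def)

lemma mem_cls_iff: "f \<in> F \<Longrightarrow> g \<in> cls f \<longleftrightarrow> g \<in> F \<and> f - g \<in> null_span"
  by (auto simp: tensor_class_def tensor_rel_def)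

lemma self_mem_cls: "f \<in> F \<Longrightarrow> f \<in> cls f"
  by (simp add: mem_cls_iff free.span_zero)

lemma carrier_tensor: "carrier AB = cls ` F"
  by (auto simp: tensor_algebra_def tensor_class_def quotient_def)

lemma cls_in_carrier [simp]: "f \<in> F \<Longrightarrow> cls f \<in> carrier AB"
  by (simp add: carrier_tensor)

text \<open>The operations of \<open>tensor_algebra\<close> are unions over representatives. When
  \<open>h\<close> is constant on the class, a union of equal sets is that set, provided the class
  is inhabited.\<close>

lemma Union_cls:
  assumes "f \<in> F" "\<And>f'. f' \<in> F \<Longrightarrow> f - f' \<in> null_span \<Longrightarrow> h f' = h f"
  shows "(\<Union>f'\<in>cls f. h f') = h f"
proof -
  have "h f' = h f" if "f' \<in> cls f" for f'
    using that assms by (simp add: mem_cls_iff)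
  then show ?thesis
    using self_mem_cls [OF assms(1)] by blast
qed

lemma Union_cls2:
  assumes "f \<in> F" "g \<in> F" "\<And>f' g'. f' \<in> F \<Longrightarrow> g' \<in> F \<Longrightarrow> f - f' \<in> null_span \<Longrightarrow>
    g - g' \<in> null_span \<Longrightarrow> h f' g' = h f g"
  shows "(\<Union>f'\<in>cls f. \<Union>g'\<in>cls g. h f' g') = h f g"
proof -
  have "h f' g' = h f g" if "f' \<in> cls f" "g' \<in> cls g" for f' g'
    using that assms by (simp add: mem_cls_iff)
  then show ?thesis
    using self_mem_cls [OF assms(1)] self_mem_cls [OF assms(2)] by blast
qed

lemma tensor_add:
  assumes "f \<in> F" "g \<in> F"
  shows "cls f \<oplus>\<^bsub>AB\<^esub> cls g = cls (f + g)"
proof -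
  have "cls (f' + g') = cls (f + g)"
    if "f' \<in> F" "g' \<in> F" "f - f' \<in> null_span" "g - g' \<in> null_span" for f' g'
  proof -
    have "(f - f') + (g - g') \<in> null_span"
      using that by (intro free.span_add)
    then have "(f + g) - (f' + g') \<in> null_span"
      by (simp add: algebra_simps)
    then show ?thesis
      using that assms cls_eq_iff [of "f + g" "f' + g'"] by simp
  qed
  then show ?thesis
    unfolding tensor_algebra_def using Union_cls2 [OF assms, of "\<lambda>f g. cls (f + g)"] by simp
qed

lemma tensor_smult:
  assumes "f \<in> F"
  shows "c \<odot>\<^bsub>AB\<^esub> cls f = cls (free_scale c f)"
proof -
  have "cls (free_scale c f') = cls (free_scale c f)" if "f' \<in> F" "f - f' \<in> null_span" for f'
  proof -
    have "free_scale c (f - f') \<in> null_span"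
      using that by (intro free.span_scale)
    then show ?thesis
      using that assms cls_eq_iff [of "free_scale c f" "free_scale c f'"]
      by (simp add: free.scale_right_diff_distrib)
  qed
  then show ?thesis
    unfolding tensor_algebra_def using Union_cls [OF assms, of "\<lambda>f. cls (free_scale c f)"] by simp
qed

lemma tensor_zero: "\<zero>\<^bsub>AB\<^esub> = cls 0"
  by (simp add: tensor_algebra_def)

lemma module_tensor: "Module.module complex_field AB"
proof (intro Module.moduleI cring_complex_field abelian_groupI)
  fix X assume "X \<in> carrier AB"
  then obtain f where "f \<in> F" "X = cls f"
    by (auto simp: carrier_tensor)
  then show "\<exists>Y\<in>carrier AB. Y \<oplus>\<^bsub>AB\<^esub> X = \<zero>\<^bsub>AB\<^esub>"
    using free_space_diff [of 0 f] by (intro bexI [of _ "cls (- f)"]) (auto simp: tensor_add tensor_zero)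
qed (auto simp: carrier_tensor tensor_add tensor_smult tensor_zero free.scale_left_distrib
    free.scale_right_distrib ac_simps)

section \<open>Multiplication and involution of the tensor product\<close>

lemma free_mult_superset:
  assumes "finite K" "Poly_Mapping.keys f \<subseteq> K" "finite L" "Poly_Mapping.keys g \<subseteq> L"
  shows "free_mult A B f g = (\<Sum>(x\<^sub>1, x\<^sub>2)\<in>K. \<Sum>(y\<^sub>1, y\<^sub>2)\<in>L.
    Poly_Mapping.single (x\<^sub>1 \<otimes>\<^bsub>A\<^esub> y\<^sub>1, x\<^sub>2 \<otimes>\<^bsub>B\<^esub> y\<^sub>2)
      (Poly_Mapping.lookup f (x\<^sub>1, x\<^sub>2) * Poly_Mapping.lookup g (y\<^sub>1, y\<^sub>2)))"
proof -
  have "free_mult A B f g = (\<Sum>(x\<^sub>1, x\<^sub>2)\<in>Poly_Mapping.keys f. \<Sum>(y\<^sub>1, y\<^sub>2)\<in>L.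
    Poly_Mapping.single (x\<^sub>1 \<otimes>\<^bsub>A\<^esub> y\<^sub>1, x\<^sub>2 \<otimes>\<^bsub>B\<^esub> y\<^sub>2)
      (Poly_Mapping.lookup f (x\<^sub>1, x\<^sub>2) * Poly_Mapping.lookup g (y\<^sub>1, y\<^sub>2)))"
    unfolding free_mult_def case_prod_unfold
    by (intro sum.cong refl sum.mono_neutral_left) (use assms in \<open>auto simp: in_keys_iff\<close>)
  also have "\<dots> = (\<Sum>(x\<^sub>1, x\<^sub>2)\<in>K. \<Sum>(y\<^sub>1, y\<^sub>2)\<in>L.
    Poly_Mapping.single (x\<^sub>1 \<otimes>\<^bsub>A\<^esub> y\<^sub>1, x\<^sub>2 \<otimes>\<^bsub>B\<^esub> y\<^sub>2)
      (Poly_Mapping.lookup f (x\<^sub>1, x\<^sub>2) * Poly_Mapping.lookup g (y\<^sub>1, y\<^sub>2)))"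
    unfolding case_prod_unfold
    by (intro sum.mono_neutral_left) (use assms in \<open>auto simp: in_keys_iff\<close>)
  finally show ?thesis .
qed

lemma free_mult_add_left: "free_mult A B (f + f') g = free_mult A B f g + free_mult A B f' g"
proof -
  let ?K = "Poly_Mapping.keys f \<union> Poly_Mapping.keys f'"
  have "Poly_Mapping.keys (f + f') \<subseteq> ?K"
    by (rule Poly_Mapping.keys_add)
  then show ?thesis
    by (simp add: free_mult_superset [of ?K _ "Poly_Mapping.keys g"] case_prod_unfold lookup_add
        sum.distrib distrib_right single_add)
qed

lemma free_mult_scale_left: "free_mult A B (free_scale c f) g = free_scale c (free_mult A B f g)"
proof -
  have "Poly_Mapping.keys (free_scale c f) \<subseteq> Poly_Mapping.keys f"
    by (auto simp: in_keys_iff)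
  then show ?thesis
    by (simp add: free_mult_superset [of "Poly_Mapping.keys f" _ "Poly_Mapping.keys g"]
        case_prod_unfold free.scale_sum_right mult.assoc)
qed

lemma free_mult_diff_left: "free_mult A B (f - f') g = free_mult A B f g - free_mult A B f' g"
  using free_mult_add_left [of "f - f'" f' g] by simp

lemma free_mult_zero_left [simp]: "free_mult A B 0 g = 0"
  by (simp add: free_mult_def)

lemma free_mult_single [simp]:
  "free_mult A B (Poly_Mapping.single (x, y) c) (Poly_Mapping.single (x', y') d) =
    Poly_Mapping.single (x \<otimes>\<^bsub>A\<^esub> x', y \<otimes>\<^bsub>B\<^esub> y') (c * d)"
  using free_mult_superset [of "{(x, y)}" "Poly_Mapping.single (x, y) c" "{(x', y')}"
      "Poly_Mapping.single (x', y') d"]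
  by simp

text \<open>Commutativity of both factors transfers linearity and the ideal property from the left
  argument to the right one. It is available only on the carriers, hence the restriction to
  \<open>F\<close>.\<close>

lemma free_mult_commute:
  assumes "f \<in> F" "g \<in> F"
  shows "free_mult A B f g = free_mult A B g f"
  unfolding free_mult_def case_prod_unfold
  by (subst sum.swap, intro sum.cong refl)
    (use assms in \<open>auto simp: free_space_def mult.commute A.m_comm B.m_comm subset_iff mem_Times_iff\<close>)

lemma free_mult_closed [simp]: "f \<in> F \<Longrightarrow> g \<in> F \<Longrightarrow> free_mult A B f g \<in> F"
  unfolding free_mult_def case_prod_unfold
  by (intro free_space_sum free_space_single A.m_closed B.m_closed)
    (auto simp: free_space_def subset_iff mem_Times_iff)

lemma free_mult_sum_left:
  "free_mult A B (\<Sum>i\<in>I. f i) g = (\<Sum>i\<in>I. free_mult A B (f i) g)"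
  by (induction I rule: infinite_finite_induct) (simp_all add: free_mult_add_left)

lemma free_mult_sum_right:
  assumes "f \<in> F" "\<And>i. i \<in> I \<Longrightarrow> g i \<in> F"
  shows "free_mult A B f (\<Sum>i\<in>I. g i) = (\<Sum>i\<in>I. free_mult A B f (g i))"
  using assms by (simp add: free_mult_commute [of f] free_space_sum free_mult_sum_left)

text \<open>Multiplication by an elementary tensor takes each bilinearity relation to one of the
  same family, by distributivity and compatibility with scalars. The coefficient \<open>d\<close> is
  then pulled out by linearity. This is the core of the ideal property.\<close>

lemma free_mult_relation:
  assumes r: "r \<in> bilinearity_relations A B" and uv: "u \<in> carrier A" "v \<in> carrier B"
  shows "free_mult A B r (Poly_Mapping.single (u, v) d) \<in> null_span"
proof -
  have "free_mult A B r (free_gen u v) \<in> null_span"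
    using r
  proof (cases rule: relation_cases)
    case (add_left x x' y)
    then show ?thesis
      using uv null_add_left [of "x \<otimes>\<^bsub>A\<^esub> u" "x' \<otimes>\<^bsub>A\<^esub> u" "y \<otimes>\<^bsub>B\<^esub> v"]
      by (simp add: free_mult_diff_left A.l_distr)
  next
    case (add_right x y y')
    then show ?thesis
      using uv null_add_right [of "x \<otimes>\<^bsub>A\<^esub> u" "y \<otimes>\<^bsub>B\<^esub> v" "y' \<otimes>\<^bsub>B\<^esub> v"]
      by (simp add: free_mult_diff_left B.l_distr)
  next
    case (scale_left c x y)
    then show ?thesis
      using uv null_scale_left [of "x \<otimes>\<^bsub>A\<^esub> u" "y \<otimes>\<^bsub>B\<^esub> v" c]
      by (simp add: free_mult_diff_left A.smult_assoc2)
  next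
    case (scale_right c x y)
    then show ?thesis
      using uv null_scale_right [of "x \<otimes>\<^bsub>A\<^esub> u" "y \<otimes>\<^bsub>B\<^esub> v" c]
      by (simp add: free_mult_diff_left B.smult_assoc2)
  qed
  moreover have "r \<in> F"
    using r by (simp add: free.span_base null_span_subset_free_space)
  then have "free_mult A B r (Poly_Mapping.single (u, v) d) =
      free_scale d (free_mult A B r (free_gen u v))"
    using uv free_mult_scale_left [of d "free_gen u v" r]
    by (simp add: free_mult_commute [of r])
  ultimately show ?thesis
    by (simp add: free.span_scale)
qed

lemma free_mult_null_left:
  assumes "r \<in> null_span" "g \<in> F"
  shows "free_mult A B r g \<in> null_span"
  using assms(1)
proof (induction rule: free.span_induct_alt)
  case base
  then show ?case
    by (simp add: free.span_zero)
next
  case (step c r s)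
  have r: "r \<in> F"
    using step(1) by (simp add: free.span_base null_span_subset_free_space)
  have "free_mult A B r g =
      (\<Sum>k\<in>Poly_Mapping.keys g. free_mult A B r (Poly_Mapping.single k (Poly_Mapping.lookup g k)))"
    using assms(2) by (subst poly_mapping_eq_sum_single [of g], intro free_mult_sum_right r)
      (auto simp: free_space_def)
  moreover have "\<dots> \<in> null_span"
    using assms(2) by (intro free.span_sum) (auto simp: free_space_def intro!: free_mult_relation step(1))
  ultimately have "free_mult A B r g \<in> null_span"
    by simp
  then show ?case
    using step(2)
    by (simp add: free_mult_add_left free_mult_scale_left free.span_add free.span_scale)
qed

lemma tensor_mult:
  assumes "f \<in> F" "g \<in> F"
  shows "cls f \<otimes>\<^bsub>AB\<^esub> cls g = cls (free_mult A B f g)"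
proof -
  have "cls (free_mult A B f' g') = cls (free_mult A B f g)"
    if "f' \<in> F" "g' \<in> F" "f - f' \<in> null_span" "g - g' \<in> null_span" for f' g'
  proof -
    \<comment> \<open>The usual telescoping \<open>f g - f' g' = (f - f') g + f' (g - g')\<close>,
      with the last product commuted so that the null factor stands on the left.\<close>
    have "free_mult A B (f - f') g + free_mult A B (g - g') f' \<in> null_span"
      using that assms by (intro free.span_add free_mult_null_left)
    also have "free_mult A B (f - f') g + free_mult A B (g - g') f' =
        free_mult A B f g - free_mult A B f' g'"
      using that assms by (simp add: free_mult_diff_left free_mult_commute [of _ f'])
    finally show ?thesis
      using that assms cls_eq_iff [of "free_mult A B f g" "free_mult A B f' g'"] by simp
  qed
  then show ?thesis
    unfolding tensor_algebra_def using Union_cls2 [OF assms, of "\<lambda>f g. cls (free_mult A B f g)"]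
    by simp
qed

section \<open>The involution on classes\<close>

lemma free_star_superset:
  assumes "finite K" "Poly_Mapping.keys f \<subseteq> K"
  shows "free_star A B f = (\<Sum>(x\<^sub>1, x\<^sub>2)\<in>K.
    Poly_Mapping.single (star A x\<^sub>1, star B x\<^sub>2) (cnj (Poly_Mapping.lookup f (x\<^sub>1, x\<^sub>2))))"
  unfolding free_star_def case_prod_unfold
  by (intro sum.mono_neutral_left) (use assms in \<open>auto simp: in_keys_iff\<close>)

lemma free_star_add: "free_star A B (f + g) = free_star A B f + free_star A B g"
proof -
  let ?K = "Poly_Mapping.keys f \<union> Poly_Mapping.keys g"
  have "Poly_Mapping.keys (f + g) \<subseteq> ?K"
    by (rule Poly_Mapping.keys_add)
  then show ?thesis
    by (simp add: free_star_superset [of ?K] case_prod_unfold lookup_add sum.distrib single_add)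
qed

lemma free_star_diff: "free_star A B (f - g) = free_star A B f - free_star A B g"
  using free_star_add [of "f - g" g] by simp

lemma free_star_scale: "free_star A B (free_scale c f) = free_scale (cnj c) (free_star A B f)"
proof -
  have "Poly_Mapping.keys (free_scale c f) \<subseteq> Poly_Mapping.keys f"
    by (auto simp: in_keys_iff)
  then show ?thesis
    by (simp add: free_star_superset [of "Poly_Mapping.keys f"] case_prod_unfold
        free.scale_sum_right)
qed

lemma free_star_zero [simp]: "free_star A B 0 = 0"
  by (simp add: free_star_def)

lemma free_star_single [simp]:
  "free_star A B (Poly_Mapping.single (x, y) c) = Poly_Mapping.single (star A x, star B y) (cnj c)"
  using free_star_superset [of "{(x, y)}" "Poly_Mapping.single (x, y) c"] by simp

lemma free_star_sum: "free_star A B (\<Sum>i\<in>I. f i) = (\<Sum>i\<in>I. free_star A B (f i))"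
  by (induction I rule: infinite_finite_induct) (simp_all add: free_star_add)

lemma free_star_closed [simp]: "f \<in> F \<Longrightarrow> free_star A B f \<in> F"
  unfolding free_star_def case_prod_unfold
  by (intro free_space_sum free_space_single A.star_closed B.star_closed)
    (auto simp: free_space_def subset_iff mem_Times_iff)

text \<open>The involution takes each relation to one of the same family, with the scalar conjugated
  in the two scaling families.\<close>

lemma free_star_null:
  assumes "r \<in> null_span"
  shows "free_star A B r \<in> null_span"
  using assms
proof (induction rule: free.span_induct_alt)
  case base
  then show ?case
    by (simp add: free.span_zero)
next
  case (step c r s)
  from step(1) have "free_star A B r \<in> null_span"
  proof (cases rule: relation_cases)
    case (add_left x x' y)
    then show ?thesis
      using null_add_left [of "star A x" "star A x'" "star B y"]
      by (simp add: free_star_diff A.star_add A.star_closed B.star_closed)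
  next
    case (add_right x y y')
    then show ?thesis
      using null_add_right [of "star A x" "star B y" "star B y'"]
      by (simp add: free_star_diff B.star_add A.star_closed B.star_closed)
  next
    case (scale_left c x y)
    then show ?thesis
      using null_scale_left [of "star A x" "star B y" "cnj c"]
      by (simp add: free_star_diff A.star_smult A.star_closed B.star_closed)
  next
    case (scale_right c x y)
    then show ?thesis
      using null_scale_right [of "star A x" "star B y" "cnj c"]
      by (simp add: free_star_diff B.star_smult A.star_closed B.star_closed)
  qed
  then show ?case
    using step(2) by (simp add: free_star_add free_star_scale free.span_add free.span_scale)
qed

lemma tensor_star:
  assumes "f \<in> F"
  shows "star AB (cls f) = cls (free_star A B f)"
proof -
  have "cls (free_star A B f') = cls (free_star A B f)" if "f' \<in> F" "f - f' \<in> null_span" for f'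
    using free_star_null [OF that(2)] that assms cls_eq_iff [of "free_star A B f" "free_star A B f'"]
    by (simp add: free_star_diff)
  then show ?thesis
    unfolding tensor_algebra_def using Union_cls [OF assms, of "\<lambda>f. cls (free_star A B f)"] by simp
qed

end

section \<open>Seminorms on the tensor product and the projective topology\<close>

context involutive_algebra_pair
begin

lemma bilinear_form_null:
  assumes "bilinear_form A B b" "r \<in> null_span"
  shows "linear_extension b r = 0"
  using assms(2)
proof (induction rule: free.span_induct_alt)
  case (step c r s)
  from step(1) have "linear_extension b r = 0"
    by (cases rule: relation_cases)
      (use assms(1) in \<open>simp_all add: bilinear_form_def linear_extension_diff\<close>)
  then show ?case
    using step(2) by (simp add: linear_extension_add linear_extension_scale)
qed simp

text \<open>An arbitrary representative is evaluated; for bilinear \<open>b\<close> the choice is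
  immaterial because linear extensions vanish on the null span.\<close>

definition tensor_functional :: "('a \<times> 'b \<Rightarrow> complex) \<Rightarrow> ('a \<times> 'b \<Rightarrow>\<^sub>0 complex) set \<Rightarrow> complex" where
  "tensor_functional b X = linear_extension b (SOME f. f \<in> X)"

lemma tensor_functional_cls:
  assumes "bilinear_form A B b" "f \<in> F"
  shows "tensor_functional b (cls f) = linear_extension b f"
proof -
  have "(SOME g. g \<in> cls f) \<in> cls f"
    using self_mem_cls [OF assms(2)] by (rule someI)
  then have "linear_extension b (f - (SOME g. g \<in> cls f)) = 0"
    using assms by (intro bilinear_form_null) (auto simp: mem_cls_iff)
  then show ?thesis
    by (simp add: tensor_functional_def linear_extension_diff)
qed

lemma tensor_eq: "tensor A B x y = cls (free_gen x y)"
  by (simp add: tensor_def)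

lemma tensor_add_left:
  assumes "x \<in> carrier A" "x' \<in> carrier A" "y \<in> carrier B"
  shows "tensor A B (x \<oplus>\<^bsub>A\<^esub> x') y = tensor A B x y \<oplus>\<^bsub>AB\<^esub> tensor A B x' y"
  using null_add_left [OF assms] assms cls_eq_iff [of "free_gen (x \<oplus>\<^bsub>A\<^esub> x') y" "free_gen x y + free_gen x' y"]
  by (simp add: tensor_eq tensor_add diff_diff_eq)

lemma tensor_add_right:
  assumes "x \<in> carrier A" "y \<in> carrier B" "y' \<in> carrier B"
  shows "tensor A B x (y \<oplus>\<^bsub>B\<^esub> y') = tensor A B x y \<oplus>\<^bsub>AB\<^esub> tensor A B x y'"
  using null_add_right [OF assms] assms cls_eq_iff [of "free_gen x (y \<oplus>\<^bsub>B\<^esub> y')" "free_gen x y + free_gen x y'"]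
  by (simp add: tensor_eq tensor_add diff_diff_eq)

lemma tensor_closed [simp]: "x \<in> carrier A \<Longrightarrow> y \<in> carrier B \<Longrightarrow> tensor A B x y \<in> carrier AB"
  by (simp add: tensor_eq)

text \<open>The product-rule splitting of an increment, on which joint continuity of the tensor map
  rests.\<close>

lemma tensor_minus_tensor:
  assumes "x \<in> carrier A" "x' \<in> carrier A" "y \<in> carrier B" "y' \<in> carrier B"
  shows "tensor A B x' y' \<ominus>\<^bsub>AB\<^esub> tensor A B x y =
    tensor A B (x' \<ominus>\<^bsub>A\<^esub> x) y' \<oplus>\<^bsub>AB\<^esub> tensor A B x (y' \<ominus>\<^bsub>B\<^esub> y)"
proof -
  interpret AB: Module.module complex_field AB
    by (rule module_tensor)
  have "x' = (x' \<ominus>\<^bsub>A\<^esub> x) \<oplus>\<^bsub>A\<^esub> x" "y' = (y' \<ominus>\<^bsub>B\<^esub> y) \<oplus>\<^bsub>B\<^esub> y"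
    using assms by (simp_all add: A.M.minus_eq B.M.minus_eq A.M.a_assoc B.M.a_assoc A.M.l_neg B.M.l_neg)
  then have "tensor A B x' y' = tensor A B (x' \<ominus>\<^bsub>A\<^esub> x) y' \<oplus>\<^bsub>AB\<^esub> tensor A B x y'"
    "tensor A B x y' = tensor A B x (y' \<ominus>\<^bsub>B\<^esub> y) \<oplus>\<^bsub>AB\<^esub> tensor A B x y"
    using assms tensor_add_left [of "x' \<ominus>\<^bsub>A\<^esub> x" x y'] tensor_add_right [of x "y' \<ominus>\<^bsub>B\<^esub> y" y]
    by simp_all
  then show ?thesis
    using assms by (simp add: AB.M.minus_eq AB.M.a_assoc AB.M.r_neg)
qed

definition sup_functional :: "('i \<Rightarrow> 'a \<times> 'b \<Rightarrow> complex) \<Rightarrow> ('a \<times> 'b \<Rightarrow>\<^sub>0 complex) set \<Rightarrow> real" where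
  "sup_functional b X = (SUP i. cmod (tensor_functional (b i) X))"

context
  fixes b :: "'i \<Rightarrow> 'a \<times> 'b \<Rightarrow> complex" and p :: "'a \<Rightarrow> real" and q :: "'b \<Rightarrow> real"
  assumes b: "\<And>i. bilinear_form A B (b i)"
    and bound: "\<And>i x y. x \<in> carrier A \<Longrightarrow> y \<in> carrier B \<Longrightarrow> cmod (b i (x, y)) \<le> p x * q y"
begin

text \<open>Any one representative of \<open>X\<close> yields a bound on all the functionals at
  once, since \<open>p\<close> and \<open>q\<close> do not depend on the index. This makes the real
  supremum meaningful.\<close>

lemma cmod_le_sup_functional:
  assumes "X \<in> carrier AB"
  shows "cmod (tensor_functional (b i) X) \<le> sup_functional b X"
proof -
  obtain f where f: "f \<in> F" "X = cls f"
    using assms by (auto simp: carrier_tensor)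
  let ?M = "\<Sum>k\<in>Poly_Mapping.keys f. cmod (Poly_Mapping.lookup f k) * (p (fst k) * q (snd k))"
  have "cmod (tensor_functional (b j) X) \<le> ?M" for j
    unfolding f(2) tensor_functional_cls [OF b f(1)] linear_extension_def
  proof (intro sum_norm_le)
    fix k assume "k \<in> Poly_Mapping.keys f"
    then have "cmod (b j k) \<le> p (fst k) * q (snd k)"
      using f(1) bound [of "fst k" "snd k" j] by (auto simp: free_space_def)
    then show "cmod (Poly_Mapping.lookup f k * b j k) \<le>
        cmod (Poly_Mapping.lookup f k) * (p (fst k) * q (snd k))"
      by (simp add: norm_mult mult_left_mono)
  qed
  then show ?thesis
    unfolding sup_functional_def by (intro cSUP_upper) (auto simp: bdd_above_def)
qed

lemma sup_functional_tensor_le: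
  assumes "x \<in> carrier A" "y \<in> carrier B"
  shows "sup_functional b (tensor A B x y) \<le> p x * q y"
  unfolding sup_functional_def
  by (rule cSUP_least) (use assms bound in \<open>auto simp: tensor_eq tensor_functional_cls [OF b]\<close>)

lemma seminorm_sup_functional: "seminorm_on AB (sup_functional b)"
  unfolding seminorm_on_def
proof (intro conjI ballI allI)
  have nonneg: "0 \<le> sup_functional b X" if "X \<in> carrier AB" for X
    using cmod_le_sup_functional [OF that] norm_ge_zero order_trans by blast
  have scale: "sup_functional b (c \<odot>\<^bsub>AB\<^esub> X) \<le> cmod c * sup_functional b X"
    if X: "X \<in> carrier AB" for X c
  proof -
    obtain f where f: "f \<in> F" "X = cls f"
      using X by (auto simp: carrier_tensor)
    have "cmod (tensor_functional (b i) (c \<odot>\<^bsub>AB\<^esub> X)) = cmod c * cmod (tensor_functional (b i) X)" for i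
      using f by (simp add: tensor_smult tensor_functional_cls [OF b] linear_extension_scale norm_mult)
    then show ?thesis
      unfolding sup_functional_def [of _ "c \<odot>\<^bsub>AB\<^esub> X"]
      by (intro cSUP_least) (auto intro!: mult_left_mono cmod_le_sup_functional [OF X])
  qed
  fix X assume X: "X \<in> carrier AB"
  then show "0 \<le> sup_functional b X"
    by (rule nonneg)
  from X obtain f where f: "f \<in> F" "X = cls f"
    by (auto simp: carrier_tensor)
  have cX: "c \<odot>\<^bsub>AB\<^esub> X \<in> carrier AB" for c
    using f by (simp add: tensor_smult)
  show "sup_functional b (c \<odot>\<^bsub>AB\<^esub> X) = cmod c * sup_functional b X" for c
  proof (rule antisym)
    show "cmod c * sup_functional b X \<le> sup_functional b (c \<odot>\<^bsub>AB\<^esub> X)"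
    proof (cases "c = 0")
      case False
      then have "sup_functional b X \<le> cmod (inverse c) * sup_functional b (c \<odot>\<^bsub>AB\<^esub> X)"
        using scale [OF cX [of c], of "inverse c"] f by (simp add: tensor_smult)
      then show ?thesis
        using False by (simp add: norm_divide field_simps)
    qed (simp add: nonneg cX)
  qed (rule scale [OF X])
  fix Y assume Y: "Y \<in> carrier AB"
  then obtain g where g: "g \<in> F" "Y = cls g"
    by (auto simp: carrier_tensor)
  show "sup_functional b (X \<oplus>\<^bsub>AB\<^esub> Y) \<le> sup_functional b X + sup_functional b Y"
    unfolding sup_functional_def [of _ "X \<oplus>\<^bsub>AB\<^esub> Y"]
  proof (rule cSUP_least)
    fix i
    have "tensor_functional (b i) (X \<oplus>\<^bsub>AB\<^esub> Y) = tensor_functional (b i) X + tensor_functional (b i) Y"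
      using f g by (simp add: tensor_add tensor_functional_cls [OF b] linear_extension_add)
    then show "cmod (tensor_functional (b i) (X \<oplus>\<^bsub>AB\<^esub> Y)) \<le> sup_functional b X + sup_functional b Y"
      using norm_triangle_mono [OF cmod_le_sup_functional [OF X] cmod_le_sup_functional [OF Y]]
      by simp
  qed simp
qed

end

text \<open>A bilinear map dominated by a product of seminorms is jointly continuous: near
  \<open>(x, y)\<close> its increment is controlled by the two increments of the arguments.\<close>

lemma continuous_map_tensor:
  assumes p: "seminorm_on A p" and q: "seminorm_on B q" and s: "seminorm_on AB s"
    and le: "\<And>x y. x \<in> carrier A \<Longrightarrow> y \<in> carrier B \<Longrightarrow> s (tensor A B x y) \<le> p x * q y"
  shows "continuous_map (prod_topology (seminorm_topology A {p}) (seminorm_topology B {q}))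
    (seminorm_topology AB {s}) (\<lambda>(x, y). tensor A B x y)" (is "continuous_map ?S _ ?t")
proof -
  note topspace_simps = topspace_seminorm_topology [OF A.module_axioms]
    topspace_seminorm_topology [OF B.module_axioms]
  interpret AB: Module.module complex_field AB
    by (rule module_tensor)
  have ball: "openin ?S (?t -` {Y \<in> carrier AB. s (Y \<ominus>\<^bsub>AB\<^esub> X) < r} \<inter> topspace ?S)"
    if X: "X \<in> carrier AB" for X r
    unfolding openin_prod_topology_alt
  proof (intro allI impI)
    fix x y
    assume xy': "(x, y) \<in> ?t -` {Y \<in> carrier AB. s (Y \<ominus>\<^bsub>AB\<^esub> X) < r} \<inter> topspace ?S"
    then have xy: "x \<in> carrier A" "y \<in> carrier B"
      by (auto simp: topspace_simps)
    have pq: "p x \<ge> 0" "q y \<ge> 0"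
      using p q xy by (auto simp: seminorm_on_def)
    define \<delta> where "\<delta> = r - s (tensor A B x y \<ominus>\<^bsub>AB\<^esub> X)"
    have "\<delta> > 0"
      using xy' by (simp add: \<delta>_def)
    \<comment> \<open>The bound \<open>\<epsilon> \<le> 1\<close> gives
      \<open>q y' \<le> 1 + q y\<close>, so the increment stays below
      \<open>\<epsilon> * (1 + q y) + p x * \<epsilon>\<close>; the quotient makes this at most
      \<open>\<delta>\<close>.\<close>
    define \<epsilon> where "\<epsilon> = min 1 (\<delta> / (1 + q y + p x))"
    have "\<epsilon> > 0" "\<epsilon> \<le> 1"
      using \<open>\<delta> > 0\<close> pq by (auto simp: \<epsilon>_def)
    have "\<epsilon> * (1 + q y + p x) \<le> \<delta>"
      using pq by (simp add: \<epsilon>_def pos_le_divide_eq [symmetric])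
    let ?U = "{x' \<in> carrier A. p (x' \<ominus>\<^bsub>A\<^esub> x) < \<epsilon>}"
    let ?W = "{y' \<in> carrier B. q (y' \<ominus>\<^bsub>B\<^esub> y) < \<epsilon>}"
    have "s (tensor A B x' y' \<ominus>\<^bsub>AB\<^esub> X) < r" if x': "x' \<in> ?U" and y': "y' \<in> ?W" for x' y'
    proof -
      have carr: "x' \<in> carrier A" "y' \<in> carrier B" "x' \<ominus>\<^bsub>A\<^esub> x \<in> carrier A" "y' \<ominus>\<^bsub>B\<^esub> y \<in> carrier B"
        using x' y' xy by auto
      have nonneg: "0 \<le> p (x' \<ominus>\<^bsub>A\<^esub> x)" "0 \<le> q (y' \<ominus>\<^bsub>B\<^esub> y)" "0 \<le> q y'"
        using p q carr by (auto simp: seminorm_on_def)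
      have "y' = (y' \<ominus>\<^bsub>B\<^esub> y) \<oplus>\<^bsub>B\<^esub> y"
        using carr xy by (simp add: B.M.minus_eq B.M.a_assoc B.M.l_neg)
      then have "q y' \<le> q (y' \<ominus>\<^bsub>B\<^esub> y) + q y"
        using q carr xy unfolding seminorm_on_def by metis
      then have qy': "q y' \<le> 1 + q y"
        using y' \<open>\<epsilon> \<le> 1\<close> by auto
      have "s (tensor A B x' y' \<ominus>\<^bsub>AB\<^esub> tensor A B x y) \<le>
          s (tensor A B (x' \<ominus>\<^bsub>A\<^esub> x) y') + s (tensor A B x (y' \<ominus>\<^bsub>B\<^esub> y))"
        using s carr xy by (simp add: tensor_minus_tensor seminorm_on_def)
      also have "\<dots> \<le> p (x' \<ominus>\<^bsub>A\<^esub> x) * q y' + p x * q (y' \<ominus>\<^bsub>B\<^esub> y)"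
        using carr xy by (intro add_mono le) auto
      \<comment> \<open>Strictness comes from the first summand, where \<open>1 + q y\<close> is
        positive; \<open>p x\<close> may be 0.\<close>
      also have "\<dots> < \<epsilon> * (1 + q y) + p x * \<epsilon>"
      proof (rule add_less_le_mono)
        have "p (x' \<ominus>\<^bsub>A\<^esub> x) * q y' \<le> p (x' \<ominus>\<^bsub>A\<^esub> x) * (1 + q y)"
          using qy' nonneg by (intro mult_left_mono) auto
        also have "\<dots> < \<epsilon> * (1 + q y)"
          using x' pq by (intro mult_strict_right_mono) auto
        finally show "p (x' \<ominus>\<^bsub>A\<^esub> x) * q y' < \<epsilon> * (1 + q y)" .
        show "p x * q (y' \<ominus>\<^bsub>B\<^esub> y) \<le> p x * \<epsilon>"
          using y' pq by (intro mult_left_mono) auto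
      qed
      also have "\<dots> \<le> \<delta>"
        using \<open>\<epsilon> * (1 + q y + p x) \<le> \<delta>\<close> by (simp add: algebra_simps)
      finally show ?thesis
        using seminorm_minus_triangle [OF module_tensor s, of "tensor A B x' y'" "tensor A B x y" X]
          carr xy X by (simp add: \<delta>_def)
    qed
    moreover have "x \<in> ?U" "y \<in> ?W"
      using xy \<open>\<epsilon> > 0\<close> seminorm_zero [OF A.module_axioms p] seminorm_zero [OF B.module_axioms q]
      by (simp_all add: A.M.minus_eq B.M.minus_eq A.M.r_neg B.M.r_neg)
    moreover have "openin (seminorm_topology A {p}) ?U" "openin (seminorm_topology B {q}) ?W"
      using xy \<open>\<epsilon> > 0\<close>
      by (auto intro!: openin_seminorm_ball [OF A.module_axioms] openin_seminorm_ball [OF B.module_axioms])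
    ultimately show "\<exists>U W. openin (seminorm_topology A {p}) U \<and> openin (seminorm_topology B {q}) W \<and>
        x \<in> U \<and> y \<in> W \<and>
        U \<times> W \<subseteq> ?t -` {Y \<in> carrier AB. s (Y \<ominus>\<^bsub>AB\<^esub> X) < r} \<inter> topspace ?S"
      by (intro exI [of _ ?U] exI [of _ ?W]) (auto simp: topspace_simps)
  qed
  have "openin ?S (?t -` carrier AB \<inter> topspace ?S)"
  proof -
    have "?t -` carrier AB \<inter> topspace ?S = topspace ?S"
      by (auto simp: topspace_simps)
    then show ?thesis
      by (simp only: openin_topspace)
  qed
  with ball show ?thesis
    unfolding seminorm_topology_def [of AB]
    by (intro continuous_on_generated_topo) (auto simp: topspace_simps)
qed

text \<open>All admissible seminorms at once, in place of the infimum formula for projective tensor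
  seminorms; the strongest topology then arises by construction.\<close>

definition projective_seminorms ::
    "'a topology \<Rightarrow> 'b topology \<Rightarrow> (('a \<times> 'b \<Rightarrow>\<^sub>0 complex) set \<Rightarrow> real) set" where
  "projective_seminorms S T = {p. seminorm_on AB p \<and>
     continuous_map (prod_topology S T) (seminorm_topology AB {p}) (\<lambda>(x, y). tensor A B x y)}"

text \<open>Continuity is tested on the subbase, whose members involve at most one seminorm each, so
  the whole family stays compatible. Conversely, every seminorm defining a compatible topology
  already belongs to the family.\<close>

lemma is_projective_topology_projective_seminorms:
  assumes "topspace S \<subseteq> carrier A" "topspace T \<subseteq> carrier B"
  shows "is_projective_topology A S B T (seminorm_topology AB (projective_seminorms S T))"
  unfolding is_projective_topology_def tensor_compatible_topology_def
proof (intro conjI allI impI)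
  let ?P = "projective_seminorms S T" and ?t = "\<lambda>(x, y). tensor A B x y"
  show "locally_convex_topology AB (seminorm_topology AB ?P)"
    unfolding locally_convex_topology_def by (intro exI [of _ ?P]) (simp add: projective_seminorms_def)
  show "continuous_map (prod_topology S T) (seminorm_topology AB ?P) ?t"
    unfolding seminorm_topology_def
  proof (rule continuous_on_generated_topo)
    fix U assume "U \<in> insert (carrier AB)
      {{y \<in> carrier AB. p (y \<ominus>\<^bsub>AB\<^esub> x) < r} | p x r. p \<in> ?P \<and> x \<in> carrier AB \<and> 0 < r}"
    then consider "U = carrier AB" | p x r where "p \<in> ?P" "x \<in> carrier AB" "0 < r"
        "U = {y \<in> carrier AB. p (y \<ominus>\<^bsub>AB\<^esub> x) < r}"
      by blast
    then show "openin (prod_topology S T) (?t -` U \<inter> topspace (prod_topology S T))"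
    proof cases
      case 1
      have "?t -` carrier AB \<inter> topspace (prod_topology S T) = topspace (prod_topology S T)"
        using assms by (auto simp: subset_iff)
      then show ?thesis
        unfolding 1 by (simp only: openin_topspace)
    next
      case 2
      then have "openin (seminorm_topology AB {p}) U"
        by (auto intro: openin_seminorm_ball [OF module_tensor])
      then show ?thesis
        using 2(1) by (auto simp: projective_seminorms_def continuous_map_alt)
    qed
  qed (use assms in \<open>auto simp: subset_iff\<close>)
next
  fix W U assume W: "locally_convex_topology AB W \<and>
    continuous_map (prod_topology S T) W (\<lambda>(x, y). tensor A B x y)" and U: "openin W U"
  then obtain Q where Q: "\<forall>q\<in>Q. seminorm_on AB q" "W = seminorm_topology AB Q"
    by (auto simp: locally_convex_topology_def)
  have coarser: "openin (seminorm_topology AB R) G"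
    if "R' \<subseteq> R" "openin (seminorm_topology AB R') G" for R R' G
  proof -
    have "openin (seminorm_topology AB R) H" if "H \<in> insert (carrier AB)
        {{y \<in> carrier AB. p (y \<ominus>\<^bsub>AB\<^esub> x) < r} | p x r. p \<in> R' \<and> x \<in> carrier AB \<and> 0 < r}" for H
      unfolding seminorm_topology_def using that \<open>R' \<subseteq> R\<close>
      by (intro topology_generated_by_Basis) blast
    then show ?thesis
      using generate_topology_on_coarsest [OF istopology_openin] that(2)
      unfolding seminorm_topology_def [of _ R'] openin_topology_generated_by_iff by blast
  qed
  \<comment> \<open>A single \<open>q \<in> Q\<close> generates a topology coarser than
    \<open>W\<close>, so continuity into \<open>W\<close> passes to it.\<close>
  have "continuous_map (prod_topology S T) (seminorm_topology AB {q}) (\<lambda>(x, y). tensor A B x y)"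
    if "q \<in> Q" for q
    using W coarser [of "{q}" Q] that Q(2)
    by (auto simp: continuous_map_def topspace_seminorm_topology [OF module_tensor])
  then have "Q \<subseteq> projective_seminorms S T"
    using Q(1) by (auto simp: projective_seminorms_def)
  then show "openin (seminorm_topology AB (projective_seminorms S T)) U"
    using coarser U Q(2) by blast
qed

end

section \<open>Fourier matrices\<close>

text \<open>The column index \<open>j\<close> runs over all natural numbers, not only below
  \<open>n\<close>. Each row is thus a bounded sequence that is unimodular everywhere, and its
  product with its conjugate is exactly the unit.\<close>

definition fourier :: "nat \<Rightarrow> nat \<Rightarrow> nat \<Rightarrow> complex" where
  "fourier n i j = cis (2 * pi * real i / real n) ^ j"

lemma fourier_mult_cnj [simp]: "fourier n i j * cnj (fourier n i j) = 1"
  unfolding complex_norm_square [symmetric] by (simp add: fourier_def norm_power)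

text \<open>For \<open>i \<noteq> k\<close> the terms are powers of a quotient of two distinct
  \<open>n\<close>-th roots of unity. This is an \<open>n\<close>-th root of unity other than 1, so
  its geometric sum vanishes.\<close>

lemma fourier_orthogonal:
  assumes "i < n" "k < n"
  shows "(\<Sum>j<n. fourier n i j * cnj (fourier n k j)) = (if i = k then of_nat n else 0)"
proof (cases "i = k")
  case False
  let ?w = "\<lambda>i. cis (2 * pi * real i / real n)"
  have "?w i * cnj (?w k) \<noteq> 1"
  proof
    assume "?w i * cnj (?w k) = 1"
    then have "?w i * (cnj (?w k) * ?w k) = ?w k"
      by (simp add: mult.assoc [symmetric])
    then have "?w i = ?w k"
      by (simp add: cis_cnj cis_mult)
    then show False
      using bij_betw_roots_unity [of n] assms False by (auto simp: bij_betw_def inj_on_def)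
  qed
  moreover have "?w m ^ n = 1" for m
    using assms cis_multiple_2pi [of "real m"] by (simp add: DeMoivre)
  then have "(?w i * cnj (?w k)) ^ n = 1"
    by (simp add: power_mult_distrib flip: complex_cnj_power)
  ultimately have "(\<Sum>j<n. (?w i * cnj (?w k)) ^ j) = 0"
    by (simp add: geometric_sum)
  then show ?thesis
    using False by (simp add: fourier_def power_mult_distrib)
qed simp

definition fourier_form :: "nat \<Rightarrow> (nat \<Rightarrow> complex) \<times> (nat \<Rightarrow> complex) \<Rightarrow> complex" where
  "fourier_form n = (\<lambda>(x, y). (\<Sum>i<n. \<Sum>j<n. cnj (fourier n i j) * x i * y j) / of_real (n * sqrt n))"

lemma bilinear_form_fourier: "bilinear_form bounded_sequences bounded_sequences (fourier_form n)"
  by (simp add: bilinear_form_def fourier_form_def sum.distrib sum_distrib_left algebra_simps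
      add_divide_distrib)

text \<open>The Fourier matrix is \<open>sqrt n\<close> times a unitary matrix, so its bilinear form has norm at most
  \<open>sqrt n\<close> on Euclidean space, hence at most \<open>n * sqrt n\<close> with respect to the supremum norm.\<close>

lemma fourier_form_bound:
  assumes x: "bounded (range x)" and y: "bounded (range y)"
  shows "cmod (fourier_form n (x, y)) \<le> sup_norm x * sup_norm y"
proof -
  define g where "g j = (\<Sum>i<n. cnj (fourier n i j) * x i)" for j
  have "complex_of_real (\<Sum>j<n. (cmod (g j))\<^sup>2) = (\<Sum>j<n. g j * cnj (g j))"
    unfolding of_real_sum complex_norm_square ..
  also have "\<dots> = (\<Sum>j<n. \<Sum>i<n. \<Sum>k<n. x i * cnj (x k) * (fourier n k j * cnj (fourier n i j)))"
    by (simp add: g_def sum_product mult_ac)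
  \<comment> \<open>With \<open>j\<close> innermost, orthogonality leaves only the diagonal; this is
    the Parseval identity for the conjugate matrix, with factor \<open>n\<close>.\<close>
  also have "\<dots> = (\<Sum>i<n. \<Sum>k<n. x i * cnj (x k) * (\<Sum>j<n. fourier n k j * cnj (fourier n i j)))"
    unfolding sum_distrib_left
    by (subst sum.swap, rule sum.cong [OF refl], rule sum.swap)
  also have "\<dots> = (\<Sum>i<n. \<Sum>k<n. if i = k then of_nat n * (x i * cnj (x k)) else 0)"
    by (intro sum.cong refl) (auto simp: fourier_orthogonal)
  also have "\<dots> = complex_of_real (\<Sum>i<n. real n * (cmod (x i))\<^sup>2)"
    unfolding of_real_sum of_real_mult complex_norm_square by simp
  finally have "(\<Sum>j<n. (cmod (g j))\<^sup>2) = (\<Sum>i<n. real n * (cmod (x i))\<^sup>2)"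
    by (simp only: of_real_eq_iff)
  also have "\<dots> \<le> (\<Sum>i<n. real n * (sup_norm x)\<^sup>2)"
    by (intro sum_mono mult_left_mono power_mono cmod_le_sup_norm x) auto
  finally have "(\<Sum>j<n. (cmod (g j))\<^sup>2) \<le> (real n * sup_norm x)\<^sup>2"
    by (simp add: power2_eq_square mult_ac)
  \<comment> \<open>Cauchy-Schwarz against the constant 1 costs the further factor \<open>n\<close>,
    whose root is the \<open>sqrt n\<close> in the normalisation.\<close>
  then have "(\<Sum>j<n. cmod (g j))\<^sup>2 \<le> (real n * sup_norm x)\<^sup>2 * real n"
    using Cauchy_Schwarz_ineq_sum [of "\<lambda>j. cmod (g j)" "\<lambda>_. 1" "{..<n}"]
    by (simp add: mult_right_mono order_trans)
  also have "\<dots> = (real n * sqrt n * sup_norm x)\<^sup>2"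
    by (simp add: power_mult_distrib)
  finally have g: "(\<Sum>j<n. cmod (g j)) \<le> real n * sqrt n * sup_norm x"
    by (rule power2_le_imp_le) (simp add: sup_norm_nonneg x)
  have "(\<Sum>i<n. \<Sum>j<n. cnj (fourier n i j) * x i * y j) = (\<Sum>j<n. g j * y j)"
    unfolding g_def sum_distrib_right by (rule sum.swap)
  also have "cmod \<dots> \<le> (\<Sum>j<n. cmod (g j) * sup_norm y)"
    by (intro sum_norm_le) (simp add: norm_mult mult_left_mono cmod_le_sup_norm y)
  also have "\<dots> = (\<Sum>j<n. cmod (g j)) * sup_norm y"
    by (simp add: sum_distrib_right)
  also have "\<dots> \<le> real n * sqrt n * sup_norm x * sup_norm y"
    by (intro mult_right_mono g sup_norm_nonneg y)
  \<comment> \<open>For \<open>n = 0\<close> the denominator is 0, and division by zero makes the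
    form 0.\<close>
  finally show ?thesis
    using x y by (cases "n = 0")
      (simp_all add: fourier_form_def norm_divide norm_mult divide_le_eq mult_ac sup_norm_nonneg)
qed

section \<open>A counterexample on bounded sequences\<close>

interpretation bs2: involutive_algebra_pair bounded_sequences bounded_sequences
  by (rule involutive_algebra_pair.intro) (rule involutive_algebra_bounded_sequences)+

definition unit_seq :: "nat \<Rightarrow> nat \<Rightarrow> complex" where
  "unit_seq i = (\<lambda>j. if j = i then 1 else 0)"

text \<open>A representative of \<open>z\<^sub>n\<close> in the free space; its class is taken where
  needed.\<close>

definition fourier_tensor :: "nat \<Rightarrow> ((nat \<Rightarrow> complex) \<times> (nat \<Rightarrow> complex)) \<Rightarrow>\<^sub>0 complex" where
  "fourier_tensor n = (\<Sum>i<n. free_gen (unit_seq i) (fourier n i))"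

lemma bounded_unit_seq [simp]: "bounded (range (unit_seq i))"
  by (rule bounded_rangeI [where B = 1]) (simp add: unit_seq_def)

lemma bounded_fourier [simp]: "bounded (range (fourier n i))"
  by (rule bounded_rangeI [where B = 1]) (simp add: fourier_def norm_power)

lemma fourier_tensor_closed [simp]: "fourier_tensor n \<in> bs2.F"
  unfolding fourier_tensor_def by (intro bs2.free_space_sum) auto

text \<open>The conjugate matrix cancels all phases: each of the \<open>n\<close> summands pairs a
  row with its own conjugate and contributes \<open>n / (n * sqrt n)\<close>.\<close>

lemma fourier_form_fourier_tensor:
  "linear_extension (fourier_form n) (fourier_tensor n) = of_real (sqrt n)"
proof (cases "n = 0")
  case False
  have "fourier_form n (unit_seq i, fourier n i) = n / of_real (n * sqrt n)" if "i < n" for i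
  proof -
    have "(\<Sum>k<n. \<Sum>j<n. cnj (fourier n k j) * unit_seq i k * fourier n i j) =
        (\<Sum>k<n. if k = i then \<Sum>j<n. fourier n i j * cnj (fourier n i j) else 0)"
      by (intro sum.cong refl) (simp add: unit_seq_def mult.commute del: fourier_mult_cnj)
    then show ?thesis
      using that by (simp add: fourier_form_def)
  qed
  then have "linear_extension (fourier_form n) (fourier_tensor n) =
      of_real (real n * (real n / (real n * sqrt n)))"
    by (simp add: fourier_tensor_def linear_extension_sum)
  also have "real n * (real n / (real n * sqrt n)) = sqrt n"
    using False by (simp add: field_simps)
  finally show ?thesis .
qed (simp add: fourier_tensor_def)

text \<open>Additivity in the first factor, one unit sequence at a time. For \<open>n = 0\<close>
  the empty sum is compared with the generator at \<open>(0, 1)\<close>, which is null without being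
  zero.\<close>

lemma sum_unit_seq_null:
  "free_gen (\<lambda>m. if m < n then 1 else 0) (\<lambda>_. 1) - (\<Sum>i<n. free_gen (unit_seq i) (\<lambda>_. 1)) \<in> bs2.null_span"
proof (induction n)
  case 0
  then show ?case
    using bs2.null_zero_left [of "\<lambda>_. 1"] by simp
next
  case (Suc n)
  let ?q = "\<lambda>m. if m < n then 1 else 0 :: complex"
  have q: "bounded (range ?q)"
    by (rule bounded_rangeI [where B = 1]) simp
  have "(\<lambda>m. if m < Suc n then 1 else 0) = (\<lambda>m. ?q m + unit_seq n m)"
    by (auto simp: unit_seq_def)
  then have "free_gen (\<lambda>m. if m < Suc n then 1 else 0) (\<lambda>_. 1) - free_gen ?q (\<lambda>_. 1)
      - free_gen (unit_seq n) (\<lambda>_. 1) \<in> bs2.null_span"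
    using bs2.null_add_left [of ?q "unit_seq n" "\<lambda>_. 1"] q by simp
  from free.span_add [OF this Suc.IH] show ?case
    by (simp add: algebra_simps)
qed

lemma fourier_tensor_mult_star:
  "bs2.cls (fourier_tensor n) \<otimes>\<^bsub>bs2.AB\<^esub> star bs2.AB (bs2.cls (fourier_tensor n)) =
    bs2.cls (free_gen (\<lambda>m. if m < n then 1 else 0) (\<lambda>_. 1))"
proof -
  let ?z = "fourier_tensor n" and ?q = "\<lambda>m. if m < n then 1 else 0 :: complex"
  let ?m = "free_mult bounded_sequences bounded_sequences" and ?s = "free_star bounded_sequences bounded_sequences"
  let ?h = "\<lambda>i k. free_gen (\<lambda>m. unit_seq i m * unit_seq k m) (\<lambda>j. fourier n i j * cnj (fourier n k j))"
  have q: "bounded (range ?q)"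
    by (rule bounded_rangeI [where B = 1]) simp
  have star: "?s ?z = (\<Sum>k<n. free_gen (unit_seq k) (\<lambda>j. cnj (fourier n k j)))"
    by (simp add: fourier_tensor_def bs2.free_star_sum unit_seq_def if_distrib cong: if_cong)
  have mult: "?m ?z (?s ?z) = (\<Sum>i<n. \<Sum>k<n. ?h i k)"
    unfolding star unfolding fourier_tensor_def
    by (simp add: bs2.free_mult_sum_left bs2.free_mult_sum_right bounded_cnj_range)
  \<comment> \<open>On the diagonal the two generators coincide in the free space, by idempotence of
    \<open>unit_seq\<close> and unimodularity. Off the diagonal the first factor is 0, so the
    generator is only null.\<close>
  have "?h i k - (if i = k then free_gen (unit_seq i) (\<lambda>_. 1) else 0) \<in> bs2.null_span" for i k
  proof (cases "i = k")
    case True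
    moreover have "(\<lambda>m. unit_seq k m * unit_seq k m) = unit_seq k"
      by (auto simp: unit_seq_def)
    ultimately show ?thesis
      by (simp add: free.span_zero)
  next
    case False
    moreover have "(\<lambda>m. unit_seq i m * unit_seq k m) = (\<lambda>_. 0)"
      using False by (auto simp: unit_seq_def)
    moreover have "bounded (range (\<lambda>j. fourier n i j * cnj (fourier n k j)))"
      by (intro bounded_mult_range bounded_cnj_range bounded_fourier)
    ultimately show ?thesis
      using bs2.null_zero_left by simp
  qed
  then have "(\<Sum>i<n. \<Sum>k<n. ?h i k - (if i = k then free_gen (unit_seq i) (\<lambda>_. 1) else 0)) \<in> bs2.null_span"
    by (intro free.span_sum)
  then have "?m ?z (?s ?z) - (\<Sum>i<n. free_gen (unit_seq i) (\<lambda>_. 1)) \<in> bs2.null_span"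
    by (simp add: mult sum_subtractf)
  from free.span_diff [OF this sum_unit_seq_null [of n]]
  have "?m ?z (?s ?z) - free_gen ?q (\<lambda>_. 1) \<in> bs2.null_span"
    by simp
  then show ?thesis
    using q bs2.cls_eq_iff [of "?m ?z (?s ?z)" "free_gen ?q (\<lambda>_. 1)"]
    by (simp add: bs2.tensor_star bs2.tensor_mult)
qed

text \<open>A self-adjoint idempotent \<open>?Q\<close> satisfies
  \<open>p ?Q = (p ?Q)\<^sup>2\<close>, so its value is 0 or 1, and this value is the square of the
  value at \<open>z\<^sub>n\<close>.\<close>

lemma cstar_seminorm_fourier_tensor_le_1:
  assumes "cstar_seminorm_on bs2.AB p"
  shows "p (bs2.cls (fourier_tensor n)) \<le> 1"
proof -
  let ?q = "\<lambda>m. if m < n then 1 else 0 :: complex"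
  let ?Q = "bs2.cls (free_gen ?q (\<lambda>_. 1))"
  have cstar: "p (X \<otimes>\<^bsub>bs2.AB\<^esub> star bs2.AB X) = (p X)\<^sup>2" if "X \<in> carrier bs2.AB" for X
    using assms that by (simp add: cstar_seminorm_on_def)
  have "bounded (range ?q)"
    by (rule bounded_rangeI [where B = 1]) simp
  moreover have "(\<lambda>m. ?q m * cnj (?q m)) = ?q"
    by auto
  ultimately have "?Q \<in> carrier bs2.AB" "?Q \<otimes>\<^bsub>bs2.AB\<^esub> star bs2.AB ?Q = ?Q"
    by (simp_all add: bs2.tensor_star bs2.tensor_mult bounded_cnj_range)
  then have "p ?Q = (p ?Q)\<^sup>2"
    using cstar [of ?Q] by simp
  then have "p ?Q \<le> 1"
    by (auto simp: power2_eq_square)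
  then have "(p (bs2.cls (fourier_tensor n)))\<^sup>2 \<le> 1"
    using cstar [of "bs2.cls (fourier_tensor n)"] by (simp add: fourier_tensor_mult_star)
  then show ?thesis
    by (simp add: power2_le_imp_le)
qed

theorem theorem2p9:
  shows "\<exists>(A\<^sub>1 :: (nat \<Rightarrow> complex) star_algebra) T\<^sub>1 (A\<^sub>2 :: (nat \<Rightarrow> complex) star_algebra) T\<^sub>2 \<pi>.
    Kstar_algebra A\<^sub>1 T\<^sub>1 \<and> Kstar_algebra A\<^sub>2 T\<^sub>2 \<and>
    is_projective_topology A\<^sub>1 T\<^sub>1 A\<^sub>2 T\<^sub>2 \<pi> \<and>
    \<not> LCstar_topology (tensor_algebra A\<^sub>1 A\<^sub>2) \<pi>"
proof (intro exI conjI)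
  let ?\<pi> = "seminorm_topology bs2.AB (bs2.projective_seminorms sup_topology sup_topology)"
  let ?s = "bs2.sup_functional fourier_form"
  show "Kstar_algebra bounded_sequences sup_topology"
    by (rule Kstar_algebra_bounded_sequences)
  show "Kstar_algebra bounded_sequences sup_topology"
    by (rule Kstar_algebra_bounded_sequences)
  show "is_projective_topology bounded_sequences sup_topology bounded_sequences sup_topology ?\<pi>"
    by (rule bs2.is_projective_topology_projective_seminorms)
      (simp_all add: topspace_seminorm_topology [OF module_bounded_sequences])
  have bound: "cmod (fourier_form n (x, y)) \<le> sup_norm x * sup_norm y"
    if "x \<in> carrier bounded_sequences" "y \<in> carrier bounded_sequences" for n x y
    using that by (simp add: fourier_form_bound)
  have s: "seminorm_on bs2.AB ?s"
    by (rule bs2.seminorm_sup_functional [OF bilinear_form_fourier bound])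
  have "?s (tensor bounded_sequences bounded_sequences x y) \<le> sup_norm x * sup_norm y"
    if "x \<in> carrier bounded_sequences" "y \<in> carrier bounded_sequences" for x y
    by (rule bs2.sup_functional_tensor_le [where b = fourier_form and p = sup_norm and q = sup_norm,
        OF bilinear_form_fourier bound that])
  from bs2.continuous_map_tensor [OF seminorm_sup_norm seminorm_sup_norm s this]
  have s_mem: "?s \<in> bs2.projective_seminorms sup_topology sup_topology"
    using s by (simp add: bs2.projective_seminorms_def)
  interpret AB: Module.module complex_field bs2.AB
    by (rule bs2.module_tensor)
  have minus_zero: "X \<ominus>\<^bsub>bs2.AB\<^esub> \<zero>\<^bsub>bs2.AB\<^esub> = X" if "X \<in> carrier bs2.AB" for X
    using that by (simp add: AB.M.minus_eq)
  show "\<not> LCstar_topology bs2.AB ?\<pi>"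
  proof
    assume "LCstar_topology bs2.AB ?\<pi>"
    then obtain P where P: "\<And>p. p \<in> P \<Longrightarrow> cstar_seminorm_on bs2.AB p" "?\<pi> = seminorm_topology bs2.AB P"
      unfolding LCstar_topology_def by blast
    then have semi: "seminorm_on bs2.AB p" if "p \<in> P" for p
      using that by (simp add: cstar_seminorm_on_def)
    \<comment> \<open>The open unit ball of \<open>?s\<close>, written as a subbasic set centred at
      zero; it is open in \<open>?\<pi>\<close> by \<open>s_mem\<close>.\<close>
    let ?U = "{X \<in> carrier bs2.AB. ?s (X \<ominus>\<^bsub>bs2.AB\<^esub> \<zero>\<^bsub>bs2.AB\<^esub>) < 1}"
    have "openin (seminorm_topology bs2.AB P) ?U"
      unfolding P(2) [symmetric] by (rule openin_seminorm_ball [OF bs2.module_tensor s_mem]) auto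
    moreover have "\<zero>\<^bsub>bs2.AB\<^esub> \<in> ?U"
      by (simp add: minus_zero seminorm_zero [OF bs2.module_tensor s])
    ultimately obtain \<epsilon> where \<epsilon>: "\<epsilon> > 0" "\<And>X. X \<in> carrier bs2.AB \<Longrightarrow>
        (\<And>p. p \<in> P \<Longrightarrow> p (X \<ominus>\<^bsub>bs2.AB\<^esub> \<zero>\<^bsub>bs2.AB\<^esub>) < \<epsilon>) \<Longrightarrow> X \<in> ?U"
      using seminorm_ball_subset_open [OF bs2.module_tensor semi] by meson
    \<comment> \<open>Chosen so that \<open>\<epsilon> / 2 * sqrt n > 1\<close>.\<close>
    obtain n where n: "real n > (2 / \<epsilon>)\<^sup>2"
      using reals_Archimedean2 by blast
    let ?Z = "bs2.cls (fourier_tensor n)"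
    \<comment> \<open>Every \<open>p \<in> P\<close> is at most \<open>\<epsilon> / 2\<close> here,
      which puts \<open>?Y\<close> into \<open>?U\<close>, although \<open>?s\<close> takes at least
      the value \<open>\<epsilon> / 2 * sqrt n\<close>.\<close>
    let ?Y = "complex_of_real (\<epsilon> / 2) \<odot>\<^bsub>bs2.AB\<^esub> ?Z"
    have Z: "?Z \<in> carrier bs2.AB"
      by simp
    then have Y: "?Y \<in> carrier bs2.AB"
      by (intro AB.smult_closed) auto
    have scale: "p ?Y = \<epsilon> / 2 * p ?Z" if "seminorm_on bs2.AB p" for p
      using that Z \<epsilon>(1) by (simp add: seminorm_on_def)
    have "p ?Y < \<epsilon>" if "p \<in> P" for p
    proof -
      have "p ?Y \<le> \<epsilon> / 2 * 1"
        unfolding scale [OF semi [OF that]]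
        using cstar_seminorm_fourier_tensor_le_1 [OF P(1) [OF that]] \<epsilon>(1) by (intro mult_left_mono) auto
      also have "\<dots> < \<epsilon>"
        using \<epsilon>(1) by simp
      finally show ?thesis .
    qed
    then have "?Y \<in> ?U"
      using Y by (intro \<epsilon>(2)) (simp_all add: minus_zero)
    then have "\<epsilon> / 2 * ?s ?Z < 1"
      using scale [OF s] by (simp add: minus_zero Y)
    moreover have "sqrt n = cmod (bs2.tensor_functional (fourier_form n) ?Z)"
      by (simp add: bs2.tensor_functional_cls [OF bilinear_form_fourier] fourier_form_fourier_tensor)
    then have "sqrt n \<le> ?s ?Z"
      using bs2.cmod_le_sup_functional [OF bilinear_form_fourier bound Z] by simp
    moreover have "2 / \<epsilon> < sqrt n"
      using n by (rule real_less_rsqrt)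
    ultimately have "2 / \<epsilon> < ?s ?Z"
      by linarith
    with \<open>\<epsilon> / 2 * ?s ?Z < 1\<close> show False
      using \<epsilon>(1) by (simp add: field_simps)
  qed
qed

end
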